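(* Assume (A1) and (A2). Let $\bar Z\in\mathcal{Z}_\star$ and $\bar H\in\mathcal{C}(\bar Z)$. Then for every $\tilde W^{(0)}\in\mathbb{S}^n$, the sequence $$\tilde W^{(k+1)}:=\mathcal{P}^\perp\Theta_{\bar H}(\tilde W^{(k)})+\mathcal{P}\Theta^\perp_{\bar H}(\tilde W^{(k)})+\Psi$$ satisfies $$\lim_{k\to\infty}\big(\tilde W^{(k+1)}-\tilde W^{(k)}\big)=\Psi-\Pi_{\mathcal{K}}(\Psi)=\Pi_{\mathcal{K}^\circ}(\Psi),$$ where $\mathcal{K}$ and its polar cone $$\mathcal{K}^\circ=\{Y\in\mathbb{S}^n:\langle\mathcal{P}\Theta_{\bar H}(V)+\mathcal{P}^\perp\Theta^\perp_{\bar H}(V),Y\rangle\le0\ \ \forall V\in\mathbb{S}^n\}$$ are closed convex cones.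
   Context: Notation: $\mathbb{S}^n$ is the space of real symmetric $n\times n$ matrices with $\langle A,B\rangle=\mathrm{tr}(AB)$. $\Pi_+$, $\Pi_-$ are the orthogonal projections onto the PSD and NSD cones. For $F\in\{\Pi_+,\Pi_-\}$: $$F'(Z;H):=\lim_{t\downarrow0}\frac{F(Z+tH)-F(Z)}{t},\qquad F''(Z;H,W):=\lim_{t\downarrow0}\frac{F(Z+tH+\tfrac{t^2}{2}W)-F(Z)-tF'(Z;H)}{t^2/2}.$$ SDP data $C,A_1,\dots,A_m\in\mathbb{S}^n$, $b\in\mathbb{R}^m$ define $\mathcal{A}X:=(\langle A_i,X\rangle)_i$ and $\mathcal{A}^*y:=\sum_iy_iA_i$. A KKT point is $(X,y,S)$ with $\mathcal{A}X=b$, $\mathcal{A}^*y+S=C$, $X,S\succeq0$, $\langle X,S\rangle=0$. $\mathcal{X}_\star$, $\mathcal{S}_\star$ are the sets of $X$, resp. $S$, in KKT points. (A1) $\mathcal{A}$ is surjective. (A2) Some KKT point $(X_{sc},y_{sc},S_{sc})$ has $\mathrm{rank}X_{sc}+\mathrm{rank}S_{sc}=n$. Let $\mathcal{P}:=\mathcal{A}^*(\mathcal{A}\mathcal{A}^* )^{-1}\mathcal{A}$ and $\mathcal{P}^\perp:=\mathrm{Id}-\mathcal{P}$. Fix $\sigma>0$ and let $\mathcal{Z}_\star:=\{X-\sigma S:X\in\mathcal{X}_\star,S\in\mathcal{S}_\star\}$. For $\bar Z\in\mathcal{Z}_\star$: $$\delta'(\bar Z;H):=-\mathcal{P}\Pi_+'(\bar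 Z;H)-\mathcal{P}^\perp\Pi_-'(\bar Z;H),\qquad \delta''(\bar Z;H,W):=-\mathcal{P}\Pi_+''(\bar Z;H,W)-\mathcal{P}^\perp\Pi_-''(\bar Z;H,W),$$ and $\mathcal{C}(\bar Z):=\{H:\delta'(\bar Z;H)=0\}$. Let $P_0$ be the projector onto $\ker\bar Z$ and $\bar Z^\dagger$ the Moore–Penrose pseudoinverse. For $\bar H\in\mathcal{C}(\bar Z)$ let $\Upsilon:=2P_0\bar H\bar Z^\dagger\bar HP_0$ and $$\Theta_{\bar H}(V):=\Pi_+''(\bar Z;\bar H,V+\Upsilon)-\Pi_+''(\bar Z;\bar H,\Upsilon),\qquad \Theta^\perp_{\bar H}(V):=\Pi_-''(\bar Z;\bar H,V+\Upsilon)-\Pi_-''(\bar Z;\bar H,\Upsilon).$$ Let $\Psi:=\delta''(\bar Z;\bar H,\Upsilon)$ and $\mathcal{K}:=\mathrm{cl}\{\mathcal{P}\Theta_{\bar H}(V)+\mathcal{P}^\perp\Theta^\perp_{\bar H}(V):V\in\mathbb{S}^n\}$. *)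

theory Defs
  imports "HOL-Analysis.Analysis"
begin

type_synonym 'n mat = "real^'n^'n"

definition Sym :: "'n::finite mat set" where
  "Sym = {A. transpose A = A}"

definition sinner :: "'n::finite mat \<Rightarrow> 'n mat \<Rightarrow> real" where
  "sinner A B = trace (A ** B)"

definition PSD :: "'n::finite mat set" where
  "PSD = {A \<in> Sym. \<forall>x. x \<bullet> (A *v x) \<ge> 0}"

definition NSD :: "'n::finite mat set" where
  "NSD = {A \<in> Sym. \<forall>x. x \<bullet> (A *v x) \<le> 0}"

text \<open>Orthogonal projections onto the PSD / NSD cones (Frobenius norm = trace inner product on Sym).\<close>
definition Pi_plus :: "'n::finite mat \<Rightarrow> 'n mat" where
  "Pi_plus Z = closest_point PSD Z"

definition Pi_minus :: "'n::finite mat \<Rightarrow> 'n mat" where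
  "Pi_minus Z = closest_point NSD Z"

definition dir1 :: "('n::finite mat \<Rightarrow> 'n mat) \<Rightarrow> 'n mat \<Rightarrow> 'n mat \<Rightarrow> 'n mat" where
  "dir1 F Z H = Lim (at_right 0) (\<lambda>t::real. (1 / t) *\<^sub>R (F (Z + t *\<^sub>R H) - F Z))"

definition dir2 :: "('n::finite mat \<Rightarrow> 'n mat) \<Rightarrow> 'n mat \<Rightarrow> 'n mat \<Rightarrow> 'n mat \<Rightarrow> 'n mat" where
  "dir2 F Z H W = Lim (at_right 0) (\<lambda>t::real.
      (1 / (t\<^sup>2 / 2)) *\<^sub>R (F (Z + t *\<^sub>R H + (t\<^sup>2 / 2) *\<^sub>R W) - F Z - t *\<^sub>R dir1 F Z H))"

definition Aop :: "('m::finite \<Rightarrow> 'n::finite mat) \<Rightarrow> 'n mat \<Rightarrow> real^'m" where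
  "Aop A X = (\<chi> i. sinner (A i) X)"

definition Aadj :: "('m::finite \<Rightarrow> 'n::finite mat) \<Rightarrow> real^'m \<Rightarrow> 'n mat" where
  "Aadj A y = (\<Sum>i\<in>UNIV. (y $ i) *\<^sub>R A i)"

definition AAadj :: "('m::finite \<Rightarrow> 'n::finite mat) \<Rightarrow> real^'m^'m" where
  "AAadj A = (\<chi> i j. sinner (A i) (A j))"

definition Pop :: "('m::finite \<Rightarrow> 'n::finite mat) \<Rightarrow> 'n mat \<Rightarrow> 'n mat" where
  "Pop A X = Aadj A (matrix_inv (AAadj A) *v Aop A X)"

definition Pperp :: "('m::finite \<Rightarrow> 'n::finite mat) \<Rightarrow> 'n mat \<Rightarrow> 'n mat" where
  "Pperp A X = X - Pop A X"

definition KKT :: "'n::finite mat \<Rightarrow> ('m::finite \<Rightarrow> 'n mat) \<Rightarrow> real^'m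
                   \<Rightarrow> 'n mat \<Rightarrow> real^'m \<Rightarrow> 'n mat \<Rightarrow> bool" where
  "KKT C A b X y S \<longleftrightarrow> Aop A X = b \<and> Aadj A y + S = C \<and> X \<in> PSD \<and> S \<in> PSD \<and> sinner X S = 0"

definition Xstar :: "'n::finite mat \<Rightarrow> ('m::finite \<Rightarrow> 'n mat) \<Rightarrow> real^'m \<Rightarrow> 'n mat set" where
  "Xstar C A b = {X. \<exists>y S. KKT C A b X y S}"

definition Sstar :: "'n::finite mat \<Rightarrow> ('m::finite \<Rightarrow> 'n mat) \<Rightarrow> real^'m \<Rightarrow> 'n mat set" where
  "Sstar C A b = {S. \<exists>X y. KKT C A b X y S}"

definition Zstar :: "real \<Rightarrow> 'n::finite mat \<Rightarrow> ('m::finite \<Rightarrow> 'n mat) \<Rightarrow> real^'m \<Rightarrow> 'n mat set" where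
  "Zstar \<sigma> C A b = {X - \<sigma> *\<^sub>R S | X S. X \<in> Xstar C A b \<and> S \<in> Sstar C A b}"

definition delta1 :: "('m::finite \<Rightarrow> 'n::finite mat) \<Rightarrow> 'n mat \<Rightarrow> 'n mat \<Rightarrow> 'n mat" where
  "delta1 A Z H = - Pop A (dir1 Pi_plus Z H) - Pperp A (dir1 Pi_minus Z H)"

definition delta2 :: "('m::finite \<Rightarrow> 'n::finite mat) \<Rightarrow> 'n mat \<Rightarrow> 'n mat \<Rightarrow> 'n mat \<Rightarrow> 'n mat" where
  "delta2 A Z H W = - Pop A (dir2 Pi_plus Z H W) - Pperp A (dir2 Pi_minus Z H W)"

definition critical_cone :: "('m::finite \<Rightarrow> 'n::finite mat) \<Rightarrow> 'n mat \<Rightarrow> 'n mat set" where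
  "critical_cone A Z = {H \<in> Sym. delta1 A Z H = 0}"

definition ker_proj :: "'n::finite mat \<Rightarrow> 'n mat" where
  "ker_proj Z = (THE P. transpose P = P \<and> P ** P = P \<and> range (\<lambda>x. P *v x) = {x. Z *v x = 0})"

definition pinv :: "'n::finite mat \<Rightarrow> 'n mat" where
  "pinv Z = (THE M. Z ** M ** Z = Z \<and> M ** Z ** M = M \<and>
                    transpose (Z ** M) = Z ** M \<and> transpose (M ** Z) = M ** Z)"

definition Upsilon :: "'n::finite mat \<Rightarrow> 'n mat \<Rightarrow> 'n mat" where
  "Upsilon Z H = 2 *\<^sub>R (ker_proj Z ** H ** pinv Z ** H ** ker_proj Z)"

definition Theta :: "'n::finite mat \<Rightarrow> 'n mat \<Rightarrow> 'n mat \<Rightarrow> 'n mat" where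
  "Theta Z H V = dir2 Pi_plus Z H (V + Upsilon Z H) - dir2 Pi_plus Z H (Upsilon Z H)"

definition Theta_perp :: "'n::finite mat \<Rightarrow> 'n mat \<Rightarrow> 'n mat \<Rightarrow> 'n mat" where
  "Theta_perp Z H V = dir2 Pi_minus Z H (V + Upsilon Z H) - dir2 Pi_minus Z H (Upsilon Z H)"

definition Psi :: "('m::finite \<Rightarrow> 'n::finite mat) \<Rightarrow> 'n mat \<Rightarrow> 'n mat \<Rightarrow> 'n mat" where
  "Psi A Z H = delta2 A Z H (Upsilon Z H)"

definition Kcone :: "('m::finite \<Rightarrow> 'n::finite mat) \<Rightarrow> 'n mat \<Rightarrow> 'n mat \<Rightarrow> 'n mat set" where
  "Kcone A Z H = closure {Pop A (Theta Z H V) + Pperp A (Theta_perp Z H V) | V. V \<in> Sym}"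

definition Kpolar :: "('m::finite \<Rightarrow> 'n::finite mat) \<Rightarrow> 'n mat \<Rightarrow> 'n mat \<Rightarrow> 'n mat set" where
  "Kpolar A Z H = {Y \<in> Sym. \<forall>V\<in>Sym. sinner (Pop A (Theta Z H V) + Pperp A (Theta_perp Z H V)) Y \<le> 0}"

end

theory Submission
  imports Defs
begin

text \<open>
  Write \<open>\<Theta>\<close>, \<open>\<Theta>\<^sup>\<bottom>\<close> for \<open>Theta\<close>, \<open>Theta_perp\<close>. Since \<open>\<Pi>\<^sub>+ + \<Pi>\<^sub>- = id\<close> on symmetric matrices,
  \<open>\<Theta> V + \<Theta>\<^sup>\<bottom> V = V\<close>, so the recursion reads \<open>W\<^sub>k\<^sub>+\<^sub>1 = W\<^sub>k - G W\<^sub>k + \<Psi>\<close> with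
  \<open>G = P \<Theta> + P\<^sup>\<bottom> \<Theta>\<^sup>\<bottom>\<close>. As a limit of difference quotients of a projection, \<open>\<Theta>\<close> is firmly
  nonexpansive, and hence so is \<open>G\<close>. For a positively homogeneous firmly nonexpansive \<open>G\<close> the
  closure \<open>K\<close> of the range is a convex cone, and the increments of the iteration converge to the element
  of \<open>\<Psi> - K\<close> of least norm.

  It remains to show that the second-order derivative exists and that \<open>\<Theta>\<close> is positively homogeneous.
  Every symmetric \<open>H\<close> is \<open>D + [K, Z]\<close> with \<open>D\<close> commuting with \<open>Z\<close> and \<open>K\<close> skew. Conjugation with
  \<open>exp (t K\<^sub>1 + (t\<^sup>2/2) K\<^sub>2)\<close>, truncated at second order, therefore turns \<open>Z + t D\<^sub>1 + (t\<^sup>2/2) D\<^sub>2\<close>, where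
  \<open>D\<^sub>1\<close> and \<open>D\<^sub>2\<close> commute with \<open>Z\<close>, into \<open>Z + t H + (t\<^sup>2/2) W\<close> up to \<open>o(t\<^sup>2)\<close>. The projection of the
  former splits into its blocks on the positive, negative and zero eigenspaces of \<open>Z\<close>, and on the kernel
  of \<open>Z\<close> only a first-order derivative of \<open>\<Pi>\<^sub>+\<close> is left.
\<close>

section \<open>Firmly nonexpansive maps\<close>

definition firmly_nonexpansive :: "('a::real_inner \<Rightarrow> 'a) \<Rightarrow> bool" where
  "firmly_nonexpansive G \<longleftrightarrow> (\<forall>x y. (G x - G y) \<bullet> (G x - G y) \<le> (G x - G y) \<bullet> (x - y))"

lemma firmly_nonexpansiveD:
  "firmly_nonexpansive G \<Longrightarrow> (G x - G y) \<bullet> (G x - G y) \<le> (G x - G y) \<bullet> (x - y)"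
  by (auto simp: firmly_nonexpansive_def)

text \<open>Expanding \<open>|x - y|^2\<close> along \<open>G\<close> and \<open>x - G x\<close>
  leaves twice the inner product of the two differences, which firmness makes nonnegative. The extra
  term on the left later makes the differences of two orbits square-summable.\<close>

lemma firmly_nonexpansive_complement:
  assumes "firmly_nonexpansive G"
  shows "((x - G x) - (y - G y)) \<bullet> ((x - G x) - (y - G y)) + (G x - G y) \<bullet> (G x - G y)
         \<le> (x - y) \<bullet> (x - y)"
proof -
  have e: "(x - G x) - (y - G y) = (x - y) - (G x - G y)" by simp
  show ?thesis unfolding e using firmly_nonexpansiveD[OF assms, of x y]
    by (simp add: inner_diff_left inner_diff_right inner_commute)
qed

text \<open>The equation is the fixed point equation of \<open>f\<close>. Since
  \<open>x - G x\<close> is nonexpansive, \<open>f\<close> is a contraction with constant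
  \<open>1 / (1 + l) < 1\<close>.\<close>

lemma firmly_nonexpansive_resolvent:
  fixes G :: "'a::euclidean_space \<Rightarrow> 'a"
  assumes G: "firmly_nonexpansive G" and l: "l > 0"
  obtains x where "l *\<^sub>R x + G x = u"
proof -
  define f where "f x = (1 / (1 + l)) *\<^sub>R (u + (x - G x))" for x
  have lip: "dist (f x) (f y) \<le> (1 / (1 + l)) * dist x y" for x y
  proof -
    have "((x - G x) - (y - G y)) \<bullet> ((x - G x) - (y - G y)) \<le> (x - y) \<bullet> (x - y)"
      using firmly_nonexpansive_complement[OF G, of x y] inner_ge_zero[of "G x - G y"] by linarith
    then have "norm ((x - G x) - (y - G y)) \<le> norm (x - y)"
      by (simp add: norm_le)
    moreover have "f x - f y = (1 / (1 + l)) *\<^sub>R ((x - G x) - (y - G y))"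
      by (simp add: f_def algebra_simps flip: scaleR_diff_right)
    ultimately show ?thesis using l by (simp add: dist_norm divide_right_mono)
  qed
  have "\<exists>!x\<in>UNIV. f x = x"
    by (rule Banach_fix[of UNIV "1 / (1 + l)"]) (use l lip in \<open>auto simp: complete_UNIV\<close>)
  then obtain x where "f x = x" by blast
  then have "(1 + l) *\<^sub>R x = u + (x - G x)" using l
    by (metis f_def add_pos_pos divide_self_if less_numeral_extra(3) scaleR_one scaleR_scaleR times_divide_eq_right mult.right_neutral zero_less_one)
  then have "l *\<^sub>R x + G x = u" by (simp add: scaleR_left_distrib algebra_simps)
  then show thesis by (rule that)
qed

text \<open>The decomposition is obtained as the limit of \<open>l x + G x = u\<close> for \<open>l \<rightarrow> 0\<close>: the
  first term converges to the polar part, the second one to the part in the closure of the range.\<close>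
lemma moreau_decomposition_range:
  fixes G :: "'a::euclidean_space \<Rightarrow> 'a"
  assumes G: "firmly_nonexpansive G" and hom: "\<And>c x. c \<ge> 0 \<Longrightarrow> G (c *\<^sub>R x) = c *\<^sub>R G x"
  obtains k y where "u = k + y" "k \<in> closure (range G)" "\<And>x. G x \<bullet> y \<le> 0" "k \<bullet> y = 0"
proof -
  have G0: "G 0 = 0" using hom[of 0 0] by simp
  have mono: "(G x - G y) \<bullet> (x - y) \<ge> 0" for x y
    using firmly_nonexpansiveD[OF G, of x y] inner_ge_zero[of "G x - G y"] by linarith
  define l where "l n = inverse (real (Suc n))" for n
  have l: "l n > 0" for n by (simp add: l_def)
  have l0: "l \<longlonglongrightarrow> 0" unfolding l_def by (rule LIMSEQ_inverse_real_of_nat)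
  have "\<exists>x. l n *\<^sub>R x + G x = u" for n
    using firmly_nonexpansive_resolvent[OF G l] by metis
  then obtain x where x: "\<And>n. l n *\<^sub>R x n + G (x n) = u" by metis
  define y where "y n = l n *\<^sub>R x n" for n
  have Gx: "G (x n) = u - y n" for n using x[of n] by (simp add: y_def algebra_simps)
  \<comment> \<open>Monotonicity between \<open>x n\<close> and \<open>z\<close>, multiplied by
    \<open>l n\<close>. Only \<open>y n\<close> is left, which stays bounded even if
    \<open>x n\<close> does not.\<close>
  have ineq: "(u - y n - G z) \<bullet> (y n - l n *\<^sub>R z) \<ge> 0" for n z
  proof -
    have "(G (x n) - G z) \<bullet> (l n *\<^sub>R (x n - z)) \<ge> 0"
      using mono[of "x n" z] l[of n] by simp
    then show ?thesis by (simp add: Gx y_def scaleR_diff_right)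
  qed
  have "norm (y n) \<le> norm u" for n
  proof -
    have "y n \<bullet> y n \<le> u \<bullet> y n" using ineq[of n 0] by (simp add: G0 inner_diff_left)
    also have "\<dots> \<le> norm u * norm (y n)" by (rule norm_cauchy_schwarz)
    finally have "norm (y n) * norm (y n) \<le> norm u * norm (y n)"
      by (simp add: dot_square_norm power2_eq_square)
    then show ?thesis by (cases "y n = 0") simp_all
  qed
  then have "y n \<in> cball 0 (norm u)" for n by simp
  then obtain y' r where r: "strict_mono (r::nat\<Rightarrow>nat)" and ylim: "(y \<circ> r) \<longlonglongrightarrow> y'"
    using compact_cball unfolding compact_def by metis
  have ylim': "(\<lambda>n. y (r n)) \<longlonglongrightarrow> y'" using ylim by (simp add: o_def)
  have llim: "(\<lambda>n. l (r n)) \<longlonglongrightarrow> 0" using LIMSEQ_subseq_LIMSEQ[OF l0 r] by (simp add: o_def)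
  have ineq': "(u - y' - G z) \<bullet> y' \<ge> 0" for z
  proof -
    have "(\<lambda>n. (u - y (r n) - G z) \<bullet> (y (r n) - l (r n) *\<^sub>R z)) \<longlonglongrightarrow> (u - y' - G z) \<bullet> (y' - 0 *\<^sub>R z)"
      by (intro tendsto_intros ylim' llim)
    then have "(u - y' - G z) \<bullet> (y' - 0 *\<^sub>R z) \<ge> 0"
      by (rule tendsto_lowerbound) (use ineq in auto)
    then show ?thesis by simp
  qed
  \<comment> \<open>By homogeneity \<open>z\<close> may be scaled; a positive
    \<open>G z \<bullet> y'\<close> would violate \<open>ineq'\<close> at
    \<open>s *\<^sub>R z\<close> once \<open>s\<close> is large.\<close>
  have pol: "G z \<bullet> y' \<le> 0" for z
  proof (rule ccontr)
    assume "\<not> ?thesis" then have pos: "G z \<bullet> y' > 0" by simp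
    define s where "s = (\<bar>(u - y') \<bullet> y'\<bar> + 1) / (G z \<bullet> y')"
    have "s \<ge> 0" using pos by (simp add: s_def)
    then have "(u - y') \<bullet> y' - s * (G z \<bullet> y') \<ge> 0"
      using ineq'[of "s *\<^sub>R z"] by (simp add: hom inner_diff_left)
    moreover have "s * (G z \<bullet> y') = \<bar>(u - y') \<bullet> y'\<bar> + 1" using pos by (simp add: s_def)
    ultimately show False by linarith
  qed
  have lim: "(\<lambda>n. G (x (r n))) \<longlonglongrightarrow> u - y'"
    unfolding Gx by (intro tendsto_intros ylim')
  then have k: "u - y' \<in> closure (range G)"
    unfolding closure_sequential by (intro exI[of _ "\<lambda>n. G (x (r n))"]) auto
  \<comment> \<open>The polar inequality passes to the limit of \<open>G (x (r n))\<close>; the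
    reverse one is \<open>ineq'\<close> at \<open>z = 0\<close>.\<close>
  have "(u - y') \<bullet> y' \<le> 0"
    by (rule tendsto_upperbound[OF tendsto_inner[OF lim tendsto_const]]) (use pol in auto)
  moreover have "(u - y') \<bullet> y' \<ge> 0" using ineq'[of 0] by (simp add: G0)
  ultimately have "(u - y') \<bullet> y' = 0" by simp
  with k pol show thesis by (intro that[of "u - y'" y']) auto
qed

lemma inner_closure_le_0:
  fixes y :: "'a::real_inner"
  assumes "\<And>x. x \<in> S \<Longrightarrow> x \<bullet> y \<le> 0" "z \<in> closure S"
  shows "z \<bullet> y \<le> 0"
proof -
  obtain f where f: "\<And>n. f n \<in> S" "f \<longlonglongrightarrow> z" using assms(2) unfolding closure_sequential by blast
  show ?thesis
    by (rule tendsto_upperbound[OF tendsto_inner[OF f(2) tendsto_const]]) (use f assms(1) in auto)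
qed

text \<open>If \<open>u = k + y\<close> lies in the bipolar, then
  \<open>y \<bullet> y = u \<bullet> y \<le> 0\<close>, so \<open>u = k\<close>. As an intersection
  of half-spaces the closure is then a convex cone, which is not evident for the range of a
  nonlinear map.\<close>

lemma closure_range_eq_bipolar:
  fixes G :: "'a::euclidean_space \<Rightarrow> 'a"
  assumes G: "firmly_nonexpansive G" and hom: "\<And>c x. c \<ge> 0 \<Longrightarrow> G (c *\<^sub>R x) = c *\<^sub>R G x"
  shows "closure (range G) = {u. \<forall>y. (\<forall>x. G x \<bullet> y \<le> 0) \<longrightarrow> u \<bullet> y \<le> 0}"
proof (intro set_eqI iffI)
  fix u assume "u \<in> closure (range G)"
  then show "u \<in> {u. \<forall>y. (\<forall>x. G x \<bullet> y \<le> 0) \<longrightarrow> u \<bullet> y \<le> 0}"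
    by (auto elim!: inner_closure_le_0[rotated])
next
  fix u assume u: "u \<in> {u. \<forall>y. (\<forall>x. G x \<bullet> y \<le> 0) \<longrightarrow> u \<bullet> y \<le> 0}"
  obtain k y where ky: "u = k + y" "k \<in> closure (range G)" "\<And>x. G x \<bullet> y \<le> 0" "k \<bullet> y = 0"
    using moreau_decomposition_range[OF G hom, of u] by metis
  have "u \<bullet> y \<le> 0" using u ky(3) by blast
  then have "y \<bullet> y \<le> 0" using ky(1,4) by (simp add: inner_add_left)
  then have "y = 0" by (metis inner_ge_zero inner_eq_zero_iff antisym)
  then show "u \<in> closure (range G)" using ky by simp
qed

lemma convex_cone_closure_range:
  fixes G :: "'a::euclidean_space \<Rightarrow> 'a"
  assumes G: "firmly_nonexpansive G" and hom: "\<And>c x. c \<ge> 0 \<Longrightarrow> G (c *\<^sub>R x) = c *\<^sub>R G x"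
  shows "convex (closure (range G))" "cone (closure (range G))"
proof -
  note e = closure_range_eq_bipolar[OF assms]
  show "cone (closure (range G))"
    unfolding cone_def by (auto simp: e mult_nonneg_nonpos)
  show "convex (closure (range G))"
    unfolding convex_def by (auto simp: e inner_add_left intro!: add_nonpos_nonpos mult_nonneg_nonpos)
qed

text \<open>The increments of two orbits differ by a square-summable sequence; comparing with an orbit whose
  first increment is almost minimal shows that the norms of the increments tend to the minimum.\<close>
lemma firmly_nonexpansive_increments:
  fixes G :: "'a::euclidean_space \<Rightarrow> 'a"
  assumes G: "firmly_nonexpansive G"
    and ky: "u = k + y" "k \<in> closure (range G)" "\<And>x. G x \<bullet> y \<le> 0" "k \<bullet> y = 0"
    and w: "\<And>n. w (Suc n) = w n - G (w n) + u"
  shows "(\<lambda>n. w (Suc n) - w n) \<longlonglongrightarrow> y"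
proof -
  define T where "T x = x - G x + u" for x
  have T: "(T x - T z) \<bullet> (T x - T z) + (G x - G z) \<bullet> (G x - G z) \<le> (x - z) \<bullet> (x - z)" for x z
    using firmly_nonexpansive_complement[OF G, of x z] by (simp add: T_def algebra_simps)
  have Tne: "norm (T x - T z) \<le> norm (x - z)" for x z
    unfolding norm_le using T[of x z] inner_ge_zero[of "G x - G z"] by linarith
  define d where "d n = u - G (w n)" for n
  \<comment> \<open>Every increment lies in \<open>u - range G\<close>, on the far side of the
    hyperplane through \<open>y\<close> orthogonal to \<open>y\<close>; hence \<open>norm y\<close>
    is a lower bound for the increments.\<close>
  have dy: "d n \<bullet> y \<ge> y \<bullet> y" for n
    using ky(3)[of "w n"] ky(4) by (simp add: d_def ky(1) inner_add_left inner_diff_left)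
  have small: "eventually (\<lambda>n. norm (d n) < norm y + e) sequentially" if e: "e > 0" for e
  proof -
    \<comment> \<open>The comparison orbit starts at a point whose increment \<open>u - G x0\<close>
      is within \<open>e / 2\<close> of \<open>y\<close>; its later increments are no longer than
      the first, because \<open>T\<close> is nonexpansive.\<close>
    obtain x0 where x0: "dist (G x0) k < e / 2"
      using ky(2) e unfolding closure_approachable by (metis half_gt_zero_iff rangeE)
    define v where "v n = (T ^^ n) x0" for n
    have v: "v (Suc n) = T (v n)" for n by (simp add: v_def)
    have wT: "w (Suc n) = T (w n)" for n using w by (simp add: T_def)
    have incr: "norm (u - G (v n)) \<le> norm y + e / 2" for n
    proof (induction n)
      case 0
      have "u - G (v 0) = y + (k - G x0)" by (simp add: v_def ky(1))
      then show ?case using norm_triangle_ineq[of y "k - G x0"] x0 by (simp add: dist_norm norm_minus_commute)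
    next
      case (Suc n)
      have "u - G (v (Suc n)) = T (T (v n)) - T (v n)" by (simp add: v T_def)
      then have "norm (u - G (v (Suc n))) \<le> norm (T (v n) - v n)" using Tne by simp
      also have "T (v n) - v n = u - G (v n)" by (simp add: T_def)
      finally show ?case using Suc by simp
    qed
    define a where "a n = (w n - v n) \<bullet> (w n - v n)" for n
    \<comment> \<open>The squared distance of the two orbits drops by at least this amount in each
      step; being nonnegative it converges, so the drops tend to zero.\<close>
    have a: "(G (w n) - G (v n)) \<bullet> (G (w n) - G (v n)) \<le> a n - a (Suc n)" for n
      using T[of "w n" "v n"] by (simp add: a_def v wT)
    have "decseq a"
    proof (rule decseq_SucI)
      show "a (Suc n) \<le> a n" for n
        using a[of n] inner_ge_zero[of "G (w n) - G (v n)"] by linarith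
    qed
    moreover have "a n \<ge> 0" for n by (simp add: a_def)
    ultimately obtain L where L: "a \<longlonglongrightarrow> L" using decseq_convergent[of a 0] by metis
    have lim: "(\<lambda>n. a n - a (Suc n)) \<longlonglongrightarrow> L - L" by (intro tendsto_intros L LIMSEQ_Suc)
    have "(\<lambda>n. (G (w n) - G (v n)) \<bullet> (G (w n) - G (v n))) \<longlonglongrightarrow> 0"
      by (rule tendsto_sandwich[OF _ _ tendsto_const lim[simplified]]) (simp_all add: a)
    then have "eventually (\<lambda>n. (G (w n) - G (v n)) \<bullet> (G (w n) - G (v n)) < (e/2)\<^sup>2) sequentially"
      by (rule order_tendstoD(2)) (use e in simp)
    then have "eventually (\<lambda>n. norm (G (w n) - G (v n)) < e / 2) sequentially"
    proof eventually_elim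
      case (elim n)
      then show ?case using e
        by (intro power2_less_imp_less[of _ "e/2"]) (simp_all only: power2_norm_eq_inner)
    qed
    then show ?thesis
    proof eventually_elim
      case (elim n)
      have "d n = (u - G (v n)) - (G (w n) - G (v n))" by (simp add: d_def)
      then have "norm (d n) \<le> norm (u - G (v n)) + norm (G (w n) - G (v n))"
        using norm_triangle_ineq4 by metis
      then show ?case using incr[of n] elim by linarith
    qed
  qed
  have ge: "norm y \<le> norm (d n)" for n
  proof (cases "y = 0")
    case False
    have "norm y * norm y \<le> norm (d n) * norm y"
      using dy[of n] norm_cauchy_schwarz[of "d n" y] by (simp add: dot_square_norm power2_eq_square)
    then show ?thesis using False by simp
  qed simp
  have "(\<lambda>n. norm (d n)) \<longlonglongrightarrow> norm y"
  proof (rule order_tendstoI)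
    fix a assume "a < norm y"
    then show "eventually (\<lambda>n. a < norm (d n)) sequentially"
      by (intro always_eventually allI order.strict_trans2[OF _ ge])
  next
    fix a assume "norm y < a"
    then show "eventually (\<lambda>n. norm (d n) < a) sequentially" using small[of "a - norm y"] by simp
  qed
  then have "(\<lambda>n. (norm (d n))\<^sup>2 - (norm y)\<^sup>2) \<longlonglongrightarrow> (norm y)\<^sup>2 - (norm y)\<^sup>2"
    by (intro tendsto_diff tendsto_power tendsto_const)
  then have lim: "(\<lambda>n. (norm (d n))\<^sup>2 - (norm y)\<^sup>2) \<longlonglongrightarrow> 0" by (simp only: diff_self)
  \<comment> \<open>Together with \<open>dy\<close>, convergence of the norms forces convergence of
    the vectors.\<close>
  have up: "(norm (d n - y))\<^sup>2 \<le> (norm (d n))\<^sup>2 - (norm y)\<^sup>2" for n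
    using dy[of n] unfolding power2_norm_eq_inner
    by (simp add: inner_diff_left inner_diff_right inner_commute)
  have "(\<lambda>n. (norm (d n - y))\<^sup>2) \<longlonglongrightarrow> 0"
    by (rule tendsto_sandwich[OF _ _ tendsto_const lim]) (simp_all add: up)
  from tendsto_real_sqrt[OF this] have "(\<lambda>n. norm (d n - y)) \<longlonglongrightarrow> 0"
    by (simp only: real_sqrt_abs real_sqrt_zero abs_norm_cancel)
  then have "d \<longlonglongrightarrow> y" by (simp only: tendsto_norm_zero_iff Lim_null[of d])
  moreover have "d n = w (Suc n) - w n" for n by (simp add: d_def w)
  ultimately show ?thesis by (simp add: d_def[abs_def] w)
qed

text \<open>Expanding \<open>|x - z|^2\<close> around \<open>p\<close> shows that the variational
  inequality implies minimality; uniqueness on a closed convex set does the rest.\<close>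

lemma closest_point_eqI:
  fixes x :: "'a::euclidean_space"
  assumes "convex S" "closed S" "p \<in> S" "\<And>z. z \<in> S \<Longrightarrow> (x - p) \<bullet> (z - p) \<le> 0"
  shows "closest_point S x = p"
proof -
  have "dist x p \<le> dist x z" if "z \<in> S" for z
  proof -
    have "(x - z) \<bullet> (x - z) = (x - p) \<bullet> (x - p) - 2 * ((x - p) \<bullet> (z - p)) + (z - p) \<bullet> (z - p)"
      by (simp add: inner_diff_left inner_diff_right inner_commute)
    then have "(x - p) \<bullet> (x - p) \<le> (x - z) \<bullet> (x - z)"
      using assms(4)[OF that] inner_ge_zero[of "z - p"] by linarith
    then show ?thesis by (simp add: dist_norm norm_le)
  qed
  then show ?thesis using closest_point_unique[OF assms(1-3), of x] by auto
qed

section \<open>The projection onto the positive semidefinite cone\<close>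

lemma matrix_add_rdistrib: "((B + C) ** A) = (B ** A) + (C ** (A :: 'a::semiring_1^'n^'m))"
  by (vector matrix_matrix_mult_def sum.distrib[symmetric] distrib_right)

lemma matrix_diff_ldistrib: "(A :: 'a::ring_1^'n^'m) ** (B - C) = A ** B - A ** C"
  by (vector matrix_matrix_mult_def sum_subtractf[symmetric] right_diff_distrib)

lemma matrix_diff_rdistrib: "(B - C) ** (A :: 'a::ring_1^'n^'m) = B ** A - C ** A"
  by (vector matrix_matrix_mult_def sum_subtractf[symmetric] left_diff_distrib)

lemma matrix_uminus_left: "(- B) ** (A :: 'a::ring_1^'n^'m) = - (B ** A)"
  by (vector matrix_matrix_mult_def sum_negf)

lemma matrix_uminus_right: "B ** (- (A :: 'a::ring_1^'n^'m)) = - (B ** A)"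
  by (vector matrix_matrix_mult_def sum_negf)

lemma matrix_scaleR_left: "(c *\<^sub>R B) ** (A :: real^'n^'m) = c *\<^sub>R (B ** A)"
  by (rule scalar_matrix_assoc[symmetric])

lemma matrix_scaleR_right: "B ** (c *\<^sub>R (A :: real^'n^'m)) = c *\<^sub>R (B ** A)"
  by (simp add: matrix_scalar_ac matrix_scaleR_left)

lemmas matrix_distribs = matrix_add_ldistrib matrix_add_rdistrib matrix_diff_ldistrib matrix_diff_rdistrib
  matrix_uminus_left matrix_uminus_right matrix_scaleR_left matrix_scaleR_right

lemma transpose_add: "transpose (A + B) = transpose A + transpose B"
  by (vector transpose_def)

lemma transpose_diff: "transpose (A - B) = transpose A - transpose B"
  by (vector transpose_def)

lemma transpose_uminus: "transpose (- A) = - transpose A"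
  by (vector transpose_def)

lemma transpose_zero: "transpose 0 = 0"
  by (vector transpose_def)

lemmas transpose_simps = transpose_add transpose_diff transpose_uminus transpose_zero transpose_scalar
  matrix_transpose_mul

lemma bounded_bilinear_matrix_mult:
  "bounded_bilinear ((**) :: real^'n^'m \<Rightarrow> real^'p^'n \<Rightarrow> real^'p^'m)"
  unfolding bilinear_conv_bounded_bilinear[symmetric] bilinear_def
  by (auto intro!: linearI simp: matrix_distribs)

lemmas tendsto_matrix_mult = bounded_bilinear.tendsto[OF bounded_bilinear_matrix_mult]

lemma bounded_linear_transpose: "bounded_linear (transpose :: real^'n^'m \<Rightarrow> real^'m^'n)"
  unfolding linear_conv_bounded_linear[symmetric]
  by (auto intro!: linearI simp: transpose_simps)

lemma inner_matrix_eq_trace: "(A :: real^'n^'m) \<bullet> B = trace (transpose A ** B)"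
proof -
  have "A \<bullet> B = (\<Sum>i\<in>UNIV. \<Sum>j\<in>UNIV. A $ i $ j * B $ i $ j)"
    by (simp add: inner_vec_def)
  also have "\<dots> = (\<Sum>j\<in>UNIV. \<Sum>i\<in>UNIV. A $ i $ j * B $ i $ j)"
    by (rule sum.swap)
  finally show ?thesis by (simp add: trace_def matrix_matrix_mult_def transpose_def)
qed

lemma inner_matrix_mult_left: "(A ** B) \<bullet> C = B \<bullet> (transpose A ** (C :: real^'n^'m))"
  by (simp add: inner_matrix_eq_trace matrix_transpose_mul matrix_mul_assoc)

lemma inner_matrix_mult_right: "(A ** B) \<bullet> C = A \<bullet> ((C :: real^'n^'m) ** transpose B)"
  unfolding inner_matrix_eq_trace matrix_transpose_mul matrix_mul_assoc[symmetric]
  by (subst trace_mul_sym) (simp add: matrix_mul_assoc)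

lemma inner_transpose: "transpose A \<bullet> transpose B = (A :: real^'n^'m) \<bullet> B"
  by (subst (2) inner_commute) (simp add: inner_matrix_eq_trace trace_mul_sym[of A])

lemma inner_matrix_vector: "x \<bullet> (A *v y) = (transpose A *v x) \<bullet> (y :: real^'n)"
  by (simp add: dot_lmul_matrix)

lemma matrix_eq_0_iff: "(A :: real^'n^'m) = 0 \<longleftrightarrow> (\<forall>x. A *v x = 0)"
  by (simp add: matrix_eq)

lemma SymD: "A \<in> Sym \<Longrightarrow> transpose A = A" and SymI: "transpose A = A \<Longrightarrow> A \<in> Sym"
  by (simp_all add: Sym_def)

lemma subspace_Sym: "subspace Sym"
  by (auto simp: subspace_def Sym_def transpose_simps)

lemma closed_Sym: "closed (Sym :: (real^'n::finite^'n) set)"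
  by (rule closed_subspace[OF subspace_Sym])

lemma Sym_add: "A \<in> Sym \<Longrightarrow> B \<in> Sym \<Longrightarrow> A + B \<in> Sym"
  and Sym_diff: "A \<in> Sym \<Longrightarrow> B \<in> Sym \<Longrightarrow> A - B \<in> Sym"
  and Sym_uminus: "A \<in> Sym \<Longrightarrow> - A \<in> Sym"
  and Sym_scaleR: "A \<in> Sym \<Longrightarrow> c *\<^sub>R A \<in> Sym"
  and Sym_congruence: "A \<in> Sym \<Longrightarrow> B ** A ** transpose (B :: real^'n^'n::finite) \<in> Sym"
  by (simp_all add: Sym_def transpose_simps matrix_mul_assoc)

lemma Sym_inner: "A \<in> Sym \<Longrightarrow> x \<bullet> (A *v y) = (A *v x) \<bullet> y"
  by (subst inner_matrix_vector) (simp add: SymD)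

lemma sinner_eq_inner: "A \<in> Sym \<Longrightarrow> sinner A B = A \<bullet> B"
  by (simp add: sinner_def inner_matrix_eq_trace SymD)

section \<open>The cone of positive semidefinite matrices\<close>

lemma PSD_Sym: "A \<in> PSD \<Longrightarrow> A \<in> Sym" and PSD_nonneg: "A \<in> PSD \<Longrightarrow> x \<bullet> (A *v x) \<ge> 0"
  by (simp_all add: PSD_def)

lemma PSD_congruence: "A \<in> PSD \<Longrightarrow> B ** A ** transpose (B :: real^'n^'n::finite) \<in> PSD"
  unfolding PSD_def using Sym_congruence[of A B]
  by (simp add: inner_matrix_vector[of _ B] flip: matrix_vector_mul_assoc)

lemma PSD_add: "A \<in> PSD \<Longrightarrow> B \<in> PSD \<Longrightarrow> A + B \<in> PSD"
  and PSD_scaleR: "A \<in> PSD \<Longrightarrow> c \<ge> 0 \<Longrightarrow> c *\<^sub>R A \<in> PSD"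
  and PSD_0: "0 \<in> PSD"
  by (simp_all add: PSD_def Sym_add Sym_scaleR subspace_0[OF subspace_Sym] matrix_vector_mult_add_rdistrib
      inner_add_right flip: scaleR_matrix_vector_assoc)

lemma convex_PSD: "convex PSD"
  unfolding convex_def by (auto intro!: PSD_add PSD_scaleR)

lemma closed_PSD: "closed (PSD :: (real^'n::finite^'n) set)"
proof -
  have bl: "bounded_linear (\<lambda>A :: real^'n^'n. x \<bullet> (A *v x))" for x
    unfolding linear_conv_bounded_linear[symmetric]
    by (auto intro!: linearI simp: matrix_vector_mult_add_rdistrib inner_add_right simp flip: scaleR_matrix_vector_assoc)
  have e: "PSD = Sym \<inter> (\<Inter>x. {A :: real^'n^'n. 0 \<le> x \<bullet> (A *v x)})"
    by (auto simp: PSD_def)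
  have "closed {A :: real^'n^'n. 0 \<le> x \<bullet> (A *v x)}" for x
    by (intro closed_Collect_le continuous_intros linear_continuous_on bl)
  then show ?thesis unfolding e by (intro closed_Int closed_INT closed_Sym ballI)
qed

text \<open>Near zero the linear term decides the sign. With
  \<open>s = - a / (\<bar>b\<bar> + 1)\<close> the expression is at most \<open>s * a\<close>, which
  is negative unless \<open>a = 0\<close>.\<close>

lemma quadratic_nonneg_imp_linear_zero:
  fixes a b :: real
  assumes "\<And>s. 0 \<le> 2 * s * a + s\<^sup>2 * b"
  shows "a = 0"
proof (rule ccontr)
  assume a: "a \<noteq> 0"
  define s where "s = - a / (\<bar>b\<bar> + 1)"
  have "s * (\<bar>b\<bar> + 1) = - a" by (simp add: s_def)
  then have "s\<^sup>2 * (\<bar>b\<bar> + 1) = - (s * a)" by (simp add: power2_eq_square mult.assoc)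
  moreover have "s\<^sup>2 * b \<le> s\<^sup>2 * (\<bar>b\<bar> + 1)" by (intro mult_left_mono) auto
  moreover have "s * a < 0" using a by (simp add: s_def divide_neg_pos power2_eq_square[symmetric])
  ultimately show False using assms[of s] by linarith
qed

text \<open>A zero of the quadratic form is a minimum, so its first variation in the direction
  \<open>A *v x\<close> vanishes.\<close>

lemma PSD_null:
  assumes "A \<in> PSD" "x \<bullet> (A *v x) = 0"
  shows "A *v x = 0"
proof -
  have "(A *v x) \<bullet> (A *v x) = 0"
  proof (rule quadratic_nonneg_imp_linear_zero)
    fix s :: real
    have "0 \<le> (x + s *\<^sub>R (A *v x)) \<bullet> (A *v (x + s *\<^sub>R (A *v x)))"
      by (rule PSD_nonneg[OF assms(1)])
    also have "\<dots> = 2 * s * ((A *v x) \<bullet> (A *v x)) + s\<^sup>2 * ((A *v x) \<bullet> (A *v (A *v x)))"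
      using assms(2) Sym_inner[OF PSD_Sym[OF assms(1)], of x "A *v x"]
      by (simp add: algebra_simps inner_add_left inner_add_right inner_commute power2_eq_square)
    finally show "0 \<le> 2 * s * ((A *v x) \<bullet> (A *v x)) + s\<^sup>2 * ((A *v x) \<bullet> (A *v (A *v x)))" .
  qed
  then show ?thesis by simp
qed

text \<open>The rank-one matrix \<open>v v^T\<close>. Pairing with it evaluates a quadratic form at
  \<open>v\<close>, which links the inner product of matrices to semidefiniteness.\<close>

definition outer :: "real^'n \<Rightarrow> real^'n^'n" where
  "outer v = (\<chi> i j. v $ i * v $ j)"

lemma inner_outer: "A \<bullet> outer v = v \<bullet> (A *v v)"
  by (simp add: inner_vec_def outer_def matrix_vector_mult_def sum_distrib_left mult_ac)

lemma outer_mult: "outer v *v x = (v \<bullet> x) *\<^sub>R v"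
  by (simp add: vec_eq_iff outer_def matrix_vector_mult_def inner_vec_def sum_distrib_left mult_ac)

lemma outer_PSD: "outer v \<in> PSD"
  by (simp add: PSD_def Sym_def outer_mult inner_commute) (simp add: outer_def transpose_def mult.commute)

section \<open>Complementarity of the projection and its residual\<close>

lemma Pi_plus_PSD: "Pi_plus Z \<in> PSD"
  unfolding Pi_plus_def using closest_point_in_set[OF closed_PSD] PSD_0 by blast

lemma Pi_plus_Sym: "Pi_plus Z \<in> Sym"
  by (rule PSD_Sym[OF Pi_plus_PSD])

lemma Pi_plus_variational: "X \<in> PSD \<Longrightarrow> (Z - Pi_plus Z) \<bullet> (X - Pi_plus Z) \<le> 0"
  unfolding Pi_plus_def by (rule closest_point_dot[OF convex_PSD closed_PSD])

text \<open>The variational inequality is tested with \<open>0\<close> and with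
  \<open>2 *\<^sub>R Pi_plus Z\<close>, as usual for projections onto cones.\<close>

lemma Pi_plus_residual_inner:
  shows "(Pi_plus Z - Z) \<bullet> Pi_plus Z = 0" and "X \<in> PSD \<Longrightarrow> (Pi_plus Z - Z) \<bullet> X \<ge> 0"
proof -
  let ?P = "Pi_plus Z"
  have a: "(?P - Z) \<bullet> X \<ge> (?P - Z) \<bullet> ?P" if "X \<in> PSD" for X
    using Pi_plus_variational[OF that, of Z] by (simp add: inner_diff_left inner_diff_right)
  have "(?P - Z) \<bullet> ?P \<le> 0" using a[OF PSD_0] by simp
  moreover have "(?P - Z) \<bullet> (2 *\<^sub>R ?P) \<ge> (?P - Z) \<bullet> ?P"
    by (rule a) (simp add: PSD_scaleR Pi_plus_PSD)
  ultimately show e: "(?P - Z) \<bullet> ?P = 0" by simp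
  show "X \<in> PSD \<Longrightarrow> (Pi_plus Z - Z) \<bullet> X \<ge> 0" using a e by simp
qed

lemma Pi_plus_residual_PSD: "Z \<in> Sym \<Longrightarrow> Pi_plus Z - Z \<in> PSD"
  using Pi_plus_residual_inner(2)[OF outer_PSD, of Z]
  by (auto simp: PSD_def inner_outer intro!: Sym_diff Pi_plus_Sym)

text \<open>The first variation of \<open>\<langle>N, (1 + s B) P (1 + s B)\<^sup>T\<rangle> \<ge> 0\<close> at its zero \<open>s = 0\<close> vanishes for every \<open>B\<close>.\<close>
lemma Pi_plus_residual_mult:
  assumes "Z \<in> Sym"
  shows "(Pi_plus Z - Z) ** Pi_plus Z = 0"
proof -
  define P N where "P = Pi_plus Z" and "N = Pi_plus Z - Z"
  have P: "P \<in> Sym" "P \<in> PSD" by (simp_all add: P_def Pi_plus_PSD Pi_plus_Sym)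
  have N: "N \<in> Sym" unfolding N_def by (intro Sym_diff Pi_plus_Sym assms)
  \<comment> \<open>With this choice both first-order terms of the expansion equal
    \<open>B \<bullet> B\<close>, so their vanishing is the claim.\<close>
  define B where "B = N ** P"
  have BT: "transpose B = P ** N" by (simp add: B_def matrix_transpose_mul SymD P N)
  have N0: "N \<bullet> P = 0" unfolding N_def P_def by (rule Pi_plus_residual_inner)
  have e1: "N \<bullet> (B ** P) = B \<bullet> B"
    by (subst inner_commute, subst inner_matrix_mult_right) (simp add: SymD P B_def)
  have e2: "N \<bullet> (P ** transpose B) = B \<bullet> B"
    by (subst inner_transpose[symmetric]) (simp add: matrix_transpose_mul SymD P N e1)
  have "B \<bullet> B = 0"
  proof (rule quadratic_nonneg_imp_linear_zero)
    fix s :: real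
    have "(mat 1 + s *\<^sub>R B) ** P ** transpose (mat 1 + s *\<^sub>R B) \<in> PSD"
      by (rule PSD_congruence[OF P(2)])
    then have "0 \<le> N \<bullet> ((mat 1 + s *\<^sub>R B) ** P ** transpose (mat 1 + s *\<^sub>R B))"
      unfolding N_def by (rule Pi_plus_residual_inner(2))
    also have "\<dots> = N \<bullet> P + s * (N \<bullet> (B ** P)) + s * (N \<bullet> (P ** transpose B))
        + s\<^sup>2 * (N \<bullet> (B ** P ** transpose B))"
      by (simp add: matrix_distribs transpose_add transpose_scalar inner_add_right power2_eq_square distrib_left)
    finally show "0 \<le> 2 * s * (B \<bullet> B) + s\<^sup>2 * (N \<bullet> (B ** P ** transpose B))"
      by (simp add: N0 e1 e2)
  qed
  then show ?thesis by (simp add: B_def P_def N_def)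
qed

lemma firmly_nonexpansive_Pi_plus: "firmly_nonexpansive Pi_plus"
  unfolding firmly_nonexpansive_def
proof (intro allI)
  fix x y :: "real^'n^'n"
  show "(Pi_plus x - Pi_plus y) \<bullet> (Pi_plus x - Pi_plus y) \<le> (Pi_plus x - Pi_plus y) \<bullet> (x - y)"
    using Pi_plus_variational[OF Pi_plus_PSD[of y], of x] Pi_plus_variational[OF Pi_plus_PSD[of x], of y]
    by (simp add: inner_diff_left inner_diff_right inner_commute)
qed

lemma Pi_plus_lipschitz: "norm (Pi_plus x - Pi_plus y) \<le> norm (x - y)"
  using closest_point_lipschitz[OF convex_PSD closed_PSD, of x y] PSD_0
  by (auto simp: Pi_plus_def dist_norm)

lemma Pi_plus_eqI:
  fixes X :: "real^'n::finite^'n"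
  assumes "X \<in> PSD" "\<And>Y. Y \<in> PSD \<Longrightarrow> (X - Z) \<bullet> Y \<ge> 0" "(X - Z) \<bullet> X = 0"
  shows "Pi_plus Z = X"
  unfolding Pi_plus_def
proof (rule closest_point_eqI[OF convex_PSD closed_PSD assms(1)])
  fix Y :: "real^'n^'n" assume "Y \<in> PSD"
  from assms(2)[OF this] assms(3) show "(Z - X) \<bullet> (Y - X) \<le> 0"
    by (simp add: inner_diff_left inner_diff_right)
qed

text \<open>The residual \<open>Pi_plus (- A) + A\<close> is in the dual cone, so it suffices that \<open>X = Pi_plus (- A)\<close>
  vanishes: \<open>X\<^sup>3 + X A X = 0\<close> with both summands positive semidefinite.\<close>
lemma PSD_inner_nonneg:
  assumes A: "A \<in> PSD" and B: "B \<in> PSD"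
  shows "A \<bullet> B \<ge> 0"
proof -
  define X where "X = Pi_plus (- A)"
  have X: "X \<in> PSD" "X \<in> Sym" by (simp_all add: X_def Pi_plus_PSD Pi_plus_Sym)
  have "(X + A) ** X = 0"
    using Pi_plus_residual_mult[of "- A"] A by (simp add: X_def Sym_uminus PSD_Sym)
  then have e: "(X + A) *v (X *v x) = 0" for x
    by (simp add: matrix_vector_mul_assoc)
  have "X *v x = 0" for x
  proof -
    let ?y = "X *v x"
    have "?y \<bullet> (X *v ?y) + ?y \<bullet> (A *v ?y) = 0"
      using e[of x] by (simp add: matrix_vector_mult_add_rdistrib flip: inner_add_right)
    then have "?y \<bullet> (X *v ?y) = 0" using PSD_nonneg[OF X(1), of ?y] PSD_nonneg[OF A, of ?y] by linarith
    then have "X *v ?y = 0" by (rule PSD_null[OF X(1)])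
    then have "?y \<bullet> ?y = 0" using Sym_inner[OF X(2), of x ?y] by simp
    then show ?thesis by simp
  qed
  then have "X = 0" by (simp add: matrix_eq_0_iff)
  then show ?thesis using Pi_plus_residual_inner(2)[OF B, of "- A"] by (simp add: X_def)
qed

text \<open>Self-duality of the cone supplies the dual condition of \<open>Pi_plus_eqI\<close>.
  Projections are computed from here on by exhibiting a splitting into two orthogonal positive
  semidefinite matrices.\<close>

lemma Pi_plus_unique:
  assumes "X \<in> PSD" "N \<in> PSD" "N \<bullet> X = 0"
  shows "Pi_plus (X - N) = X"
  by (rule Pi_plus_eqI) (use assms in \<open>auto intro: PSD_inner_nonneg\<close>)

lemma uminus_PSD_iff: "- A \<in> PSD \<longleftrightarrow> A \<in> NSD"
proof -
  have "- A \<in> Sym \<longleftrightarrow> A \<in> Sym" using Sym_uminus[of A] Sym_uminus[of "- A"] by auto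
  moreover have "(- A) *v x = - (A *v x)" for x
    using scaleR_matrix_vector_assoc[of "-1" A x] by simp
  ultimately show ?thesis by (simp add: PSD_def NSD_def)
qed

lemma NSD_eq: "NSD = uminus ` PSD"
  by (metis (no_types, opaque_lifting) uminus_PSD_iff image_iff minus_minus subsetI subset_antisym)

lemma Pi_minus_eq:
  fixes Z :: "real^'n::finite^'n"
  assumes "Z \<in> Sym"
  shows "Pi_minus Z = Z - Pi_plus Z"
  unfolding Pi_minus_def
proof (rule closest_point_eqI)
  show "convex (NSD :: (real^'n^'n) set)" "closed (NSD :: (real^'n^'n) set)"
    unfolding NSD_eq by (intro convex_negations closed_negations convex_PSD closed_PSD)+
  show "Z - Pi_plus Z \<in> NSD" using Pi_plus_residual_PSD[OF assms] uminus_PSD_iff[of "Z - Pi_plus Z"] by simp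
  fix Y assume "Y \<in> (NSD :: (real^'n^'n) set)"
  then have "- Y \<in> PSD" by (simp add: uminus_PSD_iff)
  from PSD_inner_nonneg[OF Pi_plus_PSD[of Z] this] Pi_plus_residual_inner(1)[of Z]
  show "(Z - (Z - Pi_plus Z)) \<bullet> (Y - (Z - Pi_plus Z)) \<le> 0"
    by (simp add: inner_diff_left inner_diff_right inner_commute)
qed

lemma Pi_plus_scaleR:
  assumes "Z \<in> Sym" "c \<ge> 0"
  shows "Pi_plus (c *\<^sub>R Z) = c *\<^sub>R Pi_plus Z"
proof -
  have "Pi_plus (c *\<^sub>R Pi_plus Z - c *\<^sub>R (Pi_plus Z - Z)) = c *\<^sub>R Pi_plus Z"
    by (rule Pi_plus_unique)
      (use assms Pi_plus_residual_inner(1)[of Z] in \<open>auto intro!: PSD_scaleR Pi_plus_PSD Pi_plus_residual_PSD\<close>)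
  then show ?thesis by (simp add: scaleR_diff_right)
qed

section \<open>Spectral blocks and commutators\<close>

text \<open>Moving one factor \<open>A\<close> across the inner product gives
  \<open>|A ** X|^2 = X \<bullet> (A ** (A ** X))\<close>.\<close>

lemma Sym_square_mult_zero:
  assumes "A \<in> Sym" "A ** (A ** X) = 0"
  shows "A ** X = 0"
proof -
  have "(A ** X) \<bullet> (A ** X) = 0"
    by (subst inner_matrix_mult_left) (simp add: SymD assms)
  then show ?thesis by simp
qed

section \<open>Kernel projections and the pseudoinverse\<close>

lemma orthogonal_projection_exists:
  fixes S :: "(real^'n) set"
  assumes "subspace S"
  shows "\<exists>P. transpose P = P \<and> P ** P = P \<and> range (\<lambda>x. P *v x) = S"
proof -
  obtain B where B: "B \<subseteq> S" "pairwise orthogonal B" "\<And>x. x \<in> B \<Longrightarrow> norm x = 1"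
    "independent B" "card B = dim S" "span B = S"
    using orthonormal_basis_subspace[OF assms] by blast
  have fin: "finite B" using independent_bound[OF B(4)] by simp
  \<comment> \<open>The sum of \<open>b b^T\<close> over an orthonormal basis of the
    subspace.\<close>
  define P where "P = (\<Sum>b\<in>B. outer b)"
  have Px: "P *v x = (\<Sum>b\<in>B. (x \<bullet> b) *\<^sub>R b)" for x
  proof -
    have "P *v x = (\<Sum>b\<in>B. outer b *v x)"
      unfolding P_def using fin by induction (simp_all add: matrix_vector_mult_add_rdistrib)
    then show ?thesis by (simp add: outer_mult inner_commute)
  qed
  have PS: "P *v x \<in> S" for x
    unfolding Px using assms B(1) by (intro subspace_sum subspace_scale) auto
  have id: "P *v x = x" if "x \<in> S" for x
    unfolding Px by (rule orthonormal_basis_expand) (use B fin that in auto)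
  have "transpose P = P"
    unfolding P_def using fin by induction (simp_all add: transpose_simps PSD_Sym outer_PSD SymD)
  moreover have "P ** P = P"
    unfolding matrix_eq using id[OF PS] by (simp flip: matrix_vector_mul_assoc)
  moreover have "range (\<lambda>x. P *v x) = S"
    using PS id by (metis (no_types, lifting) image_subset_iff rangeI subsetI subset_antisym)
  ultimately show ?thesis by blast
qed

text \<open>The description in \<open>ker_proj\<close> determines a unique matrix: two candidates
  absorb each other, \<open>P ** Q = Q\<close> and \<open>Q ** P = P\<close>, and transposing one
  identity yields \<open>P = Q\<close>.\<close>

lemma ker_proj_spec:
  fixes Z :: "real^'n::finite^'n"
  shows "transpose (ker_proj Z) = ker_proj Z \<and> ker_proj Z ** ker_proj Z = ker_proj Z
    \<and> range (\<lambda>x. ker_proj Z *v x) = {x. Z *v x = 0}"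
  unfolding ker_proj_def
proof (rule theI')
  have "subspace {x. Z *v x = 0}"
    by (auto simp: subspace_def matrix_vector_right_distrib matrix_vector_mult_scaleR)
  from orthogonal_projection_exists[OF this]
  show "\<exists>!P. transpose P = P \<and> P ** P = P \<and> range (\<lambda>x. P *v x) = {x. Z *v x = 0}"
  proof (rule ex_ex1I)
    have absorb: "P ** Q = Q" if PP: "P ** P = P" and sub: "range (\<lambda>x. Q *v x) \<subseteq> range (\<lambda>x. P *v x)" for P Q :: "real^'n^'n"
      unfolding matrix_eq
    proof
      fix x
      obtain y where "Q *v x = P *v y" using sub by blast
      then show "(P ** Q) *v x = Q *v x" using PP
        by (metis matrix_vector_mul_assoc)
    qed
    fix P Q :: "real^'n^'n"
    assume P: "transpose P = P \<and> P ** P = P \<and> range (\<lambda>x. P *v x) = {x. Z *v x = 0}"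
      and Q: "transpose Q = Q \<and> Q ** Q = Q \<and> range (\<lambda>x. Q *v x) = {x. Z *v x = 0}"
    have "P ** Q = Q" by (rule absorb) (use P Q in simp_all)
    moreover have "Q ** P = P" by (rule absorb) (use P Q in simp_all)
    ultimately show "P = Q" by (metis P Q matrix_transpose_mul)
  qed
qed

lemma ker_proj_Sym: "ker_proj Z \<in> Sym"
  using ker_proj_spec[of Z] by (simp add: SymI)

lemma ker_proj_idem: "ker_proj Z ** ker_proj Z = ker_proj Z"
  using ker_proj_spec[of Z] by simp

lemma mult_ker_proj: "Z ** ker_proj Z = 0"
  using ker_proj_spec[of Z] by (auto simp: matrix_eq simp flip: matrix_vector_mul_assoc)

lemma ker_proj_mult: "Z \<in> Sym \<Longrightarrow> ker_proj Z ** Z = 0"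
  using arg_cong[OF mult_ker_proj[of Z], of transpose]
  by (simp add: transpose_simps SymD ker_proj_Sym)

lemma ker_proj_absorb:
  assumes "Z ** X = 0"
  shows "ker_proj Z ** X = X"
  unfolding matrix_eq
proof
  fix x
  have "Z *v (X *v x) = 0" using assms by (simp add: matrix_vector_mul_assoc)
  then obtain y where "X *v x = ker_proj Z *v y" using ker_proj_spec[of Z] by blast
  then show "(ker_proj Z ** X) *v x = X *v x"
    by (metis ker_proj_idem matrix_vector_mul_assoc)
qed

text \<open>With \<open>P\<close> the projection onto the kernel, \<open>Z + P\<close> is invertible
  and its inverse minus \<open>P\<close> satisfies the four Penrose equations. Penrose's uniqueness
  argument identifies it with \<open>pinv Z\<close>.\<close>

lemma pinv_mult:
  fixes Z :: "real^'n::finite^'n"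
  assumes Z: "Z \<in> Sym"
  shows "Z ** pinv Z = mat 1 - ker_proj Z" "ker_proj Z ** pinv Z = 0"
proof -
  define P where "P = ker_proj Z"
  have P: "transpose P = P" "P ** P = P" "Z ** P = 0" "P ** Z = 0"
    by (simp_all add: P_def SymD ker_proj_Sym ker_proj_idem mult_ker_proj ker_proj_mult Z)
  have "x = 0" if "(Z + P) *v x = 0" for x
  proof -
    have "P *v ((Z + P) *v x) = 0" using that by simp
    then have "P *v x = 0" by (simp add: matrix_vector_mul_assoc matrix_distribs P)
    moreover from this that have "Z *v x = 0" by (simp add: matrix_vector_mult_add_rdistrib)
    then obtain y where "x = P *v y" using ker_proj_spec[of Z] unfolding P_def by blast
    ultimately show ?thesis by (metis P(2) matrix_vector_mul_assoc)
  qed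
  then obtain N where N: "N ** (Z + P) = mat 1"
    using matrix_left_invertible_ker[of "Z + P"] by blast
  then have N': "(Z + P) ** N = mat 1" by (simp add: matrix_left_right_inverse)
  have PN: "P ** N = P"
  proof -
    have "P ** ((Z + P) ** N) = P" by (simp add: N')
    then show ?thesis by (simp add: matrix_mul_assoc matrix_distribs P)
  qed
  have NP: "N ** P = P"
  proof -
    have "(N ** (Z + P)) ** P = P" by (simp add: N)
    then show ?thesis by (simp add: matrix_mul_assoc[symmetric] matrix_distribs P)
  qed
  define M where "M = N - P"
  have ZM: "Z ** M = mat 1 - P" using N' by (simp add: M_def matrix_distribs P PN algebra_simps)
  have MZ: "M ** Z = mat 1 - P" using N by (simp add: M_def matrix_distribs P NP algebra_simps)
  have PM: "P ** M = 0" by (simp add: M_def matrix_distribs P PN)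
  have M: "Z ** M ** Z = Z" "M ** Z ** M = M" "transpose (Z ** M) = Z ** M" "transpose (M ** Z) = M ** Z"
    by (simp_all add: ZM MZ PM matrix_distribs transpose_diff P)
  have "pinv Z = M"
    unfolding pinv_def
  proof (rule the_equality)
    show "Z ** M ** Z = Z \<and> M ** Z ** M = M \<and> transpose (Z ** M) = Z ** M \<and> transpose (M ** Z) = M ** Z"
      using M by blast
    fix L assume L: "Z ** L ** Z = Z \<and> L ** Z ** L = L \<and> transpose (Z ** L) = Z ** L \<and> transpose (L ** Z) = L ** Z"
    \<comment> \<open>Inserting \<open>Z = Z ** M ** Z\<close> and transposing turns
      \<open>Z ** L\<close> into \<open>Z ** L ** Z ** M = Z ** M\<close>.\<close>
    have "Z ** L = transpose ((Z ** M ** Z) ** L)" using L M(1) by simp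
    also have "\<dots> = transpose (Z ** L) ** transpose (Z ** M)"
      by (simp only: matrix_transpose_mul[symmetric] matrix_mul_assoc)
    also have "\<dots> = Z ** M" using L M(3) by (simp add: matrix_mul_assoc)
    finally have 1: "Z ** L = Z ** M" .
    have "L ** Z = transpose (L ** (Z ** M ** Z))" using L M(1) by simp
    also have "\<dots> = transpose (M ** Z) ** transpose (L ** Z)"
      by (simp only: matrix_transpose_mul[symmetric] matrix_mul_assoc)
    also have "\<dots> = M ** Z ** (L ** Z)" using L M(4) by simp
    also have "\<dots> = M ** (Z ** L ** Z)" by (simp only: matrix_mul_assoc)
    finally have 2: "L ** Z = M ** Z" using L by simp
    have "L = (L ** Z) ** L" using L by simp
    also have "\<dots> = M ** (Z ** L)" by (simp add: 2 matrix_mul_assoc)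
    finally show "L = M" using 1 M(2) by (simp add: matrix_mul_assoc)
  qed
  with ZM PM show "Z ** pinv Z = mat 1 - ker_proj Z" "ker_proj Z ** pinv Z = 0"
    by (simp_all add: P_def)
qed

section \<open>Spectral projections and matrices commuting with \<open>Z\<close>\<close>

definition pos_proj :: "real^'n::finite^'n \<Rightarrow> real^'n^'n" where
  "pos_proj Z = mat 1 - ker_proj (Pi_plus Z)"

text \<open>Here \<open>Pi_plus Z - Z\<close> is the absolute value of the negative part of
  \<open>Z\<close>. Kernel projections of the two parts thus give the spectral projections without
  any choice of eigenvectors.\<close>

definition neg_proj :: "real^'n::finite^'n \<Rightarrow> real^'n^'n" where
  "neg_proj Z = mat 1 - ker_proj (Pi_plus Z - Z)"

lemma support_proj:
  assumes "A \<in> Sym" and P: "P = mat 1 - ker_proj A"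
  shows "transpose P = P" "P ** P = P" "P ** A = A" "A ** P = A" "A ** X = 0 \<Longrightarrow> P ** X = 0"
  using ker_proj_idem[of A] mult_ker_proj[of A] ker_proj_mult[OF assms(1)] ker_proj_absorb[of A X]
  by (simp_all add: P transpose_diff SymD ker_proj_Sym matrix_distribs)

text \<open>Everything follows from \<open>Z = A - B\<close> with
  \<open>A ** B = B ** A = 0\<close>, because a matrix annihilated by \<open>A\<close> or
  \<open>B\<close> is annihilated by the corresponding support projection.\<close>

lemma spectral_projections:
  fixes Z :: "real^'n::finite^'n"
  assumes Z: "Z \<in> Sym"
  shows "transpose (pos_proj Z) = pos_proj Z" "pos_proj Z ** pos_proj Z = pos_proj Z"
    and "transpose (neg_proj Z) = neg_proj Z" "neg_proj Z ** neg_proj Z = neg_proj Z"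
    and "pos_proj Z ** Z ** pos_proj Z = Pi_plus Z" "neg_proj Z ** (- Z) ** neg_proj Z = Pi_plus Z - Z"
    and "pos_proj Z ** neg_proj Z = 0" "neg_proj Z ** pos_proj Z = 0"
    and "pos_proj Z ** ker_proj Z = 0" "neg_proj Z ** ker_proj Z = 0"
    and "ker_proj Z ** pos_proj Z = 0" "ker_proj Z ** neg_proj Z = 0"
    and "pos_proj Z + neg_proj Z + ker_proj Z = mat 1"
    and "pos_proj Z ** Pi_plus Z = Pi_plus Z" "neg_proj Z ** (Pi_plus Z - Z) = Pi_plus Z - Z"
    and "Pi_plus Z ** X = 0 \<Longrightarrow> pos_proj Z ** X = 0"
    and "(Pi_plus Z - Z) ** X = 0 \<Longrightarrow> neg_proj Z ** X = 0"
proof -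
  define A where "A = Pi_plus Z"
  define B where "B = Pi_plus Z - Z"
  define P where "P = pos_proj Z"
  define N where "N = neg_proj Z"
  define R where "R = ker_proj Z"
  have A: "A \<in> Sym" "transpose A = A" and B: "B \<in> Sym" "transpose B = B"
    using Pi_plus_Sym[of Z] Sym_diff[OF Pi_plus_Sym Z] by (auto simp: A_def B_def SymD)
  have ZAB: "Z = A - B" by (simp add: A_def B_def)
  have BA: "B ** A = 0" using Pi_plus_residual_mult[OF Z] by (simp add: A_def B_def)
  have AB: "A ** B = 0" using arg_cong[OF BA, of transpose] by (simp add: transpose_simps A B)
  note P = support_proj[OF A(1), of P, unfolded P_def pos_proj_def A_def, OF refl, folded pos_proj_def A_def, folded P_def]
  note N = support_proj[OF B(1), of N, unfolded N_def neg_proj_def B_def, OF refl, folded neg_proj_def B_def, folded N_def]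
  have R: "transpose R = R" "R ** R = R" "Z ** R = 0" "\<And>X. Z ** X = 0 \<Longrightarrow> R ** X = X"
    using ker_proj_Sym[of Z] by (auto simp: R_def SymD ker_proj_idem mult_ker_proj ker_proj_absorb)
  have PB: "P ** B = 0" by (rule P(5)[OF AB])
  have BP: "B ** P = 0" using arg_cong[OF PB, of transpose] by (simp add: transpose_simps P B)
  have NP: "N ** P = 0" by (rule N(5)[OF BP])
  have PN: "P ** N = 0" using arg_cong[OF NP, of transpose] by (simp add: transpose_simps P N)
  have NA: "N ** A = 0" by (rule N(5)[OF BA])
  \<comment> \<open>From \<open>Z ** R = 0\<close>. Another factor \<open>A\<close> makes the right
    side zero, so \<open>A ** (A ** R) = 0\<close>.\<close>
  have AO: "A ** R = B ** R" using R(3) by (simp add: ZAB matrix_distribs)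
  have AO0: "A ** R = 0"
    by (rule Sym_square_mult_zero[OF A(1)]) (simp add: AO matrix_mul_assoc AB)
  then have PO: "P ** R = 0" by (rule P(5))
  have NO: "N ** R = 0" by (rule N(5)) (use AO AO0 in simp)
  have OP: "R ** P = 0" using arg_cong[OF PO, of transpose] by (simp add: transpose_simps P R)
  have ON: "R ** N = 0" using arg_cong[OF NO, of transpose] by (simp add: transpose_simps N R)
  have AN: "A ** N = 0" using arg_cong[OF NA, of transpose] by (simp add: transpose_simps N A)
  \<comment> \<open>The complement of both supports lies in the kernel of \<open>Z\<close>, so
    \<open>R\<close> fixes it, while \<open>R\<close> annihilates \<open>P\<close> and
    \<open>N\<close>; comparing gives completeness.\<close>
  have "Z ** (mat 1 - P - N) = 0" by (simp add: ZAB matrix_distribs P N BP AN)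
  then have "R ** (mat 1 - P - N) = mat 1 - P - N" by (rule R(4))
  then have "R = mat 1 - P - N" by (simp add: matrix_distribs OP ON)
  then have sum: "P + N + R = mat 1" by simp
  have PZP: "P ** Z ** P = A" by (simp add: ZAB matrix_distribs P PB)
  have NZN: "N ** (- Z) ** N = B" by (simp add: ZAB matrix_distribs N NA)
  show "transpose (pos_proj Z) = pos_proj Z" "pos_proj Z ** pos_proj Z = pos_proj Z"
    "transpose (neg_proj Z) = neg_proj Z" "neg_proj Z ** neg_proj Z = neg_proj Z"
    "pos_proj Z ** Z ** pos_proj Z = Pi_plus Z" "neg_proj Z ** (- Z) ** neg_proj Z = Pi_plus Z - Z"
    "pos_proj Z ** neg_proj Z = 0" "neg_proj Z ** pos_proj Z = 0"
    "pos_proj Z ** ker_proj Z = 0" "neg_proj Z ** ker_proj Z = 0"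
    "ker_proj Z ** pos_proj Z = 0" "ker_proj Z ** neg_proj Z = 0"
    "pos_proj Z + neg_proj Z + ker_proj Z = mat 1"
    "pos_proj Z ** Pi_plus Z = Pi_plus Z" "neg_proj Z ** (Pi_plus Z - Z) = Pi_plus Z - Z"
    "Pi_plus Z ** X = 0 \<Longrightarrow> pos_proj Z ** X = 0"
    "(Pi_plus Z - Z) ** X = 0 \<Longrightarrow> neg_proj Z ** X = 0"
    using P N R sum PZP NZN PN NP PO NO OP ON by (simp_all only: P_def N_def R_def A_def B_def)
qed

text \<open>Multiplying \<open>D Z = Z D\<close> by the positive and the negative part of \<open>Z\<close> gives a Sylvester
  equation for \<open>Z\<^sub>+ D Z\<^sub>-\<close> whose only solution is zero.\<close>
lemma commuting_blocks:
  fixes Z D :: "real^'n::finite^'n"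
  assumes Z: "Z \<in> Sym" and D: "D \<in> Sym" and comm: "D ** Z = Z ** D"
  shows "ker_proj Z ** D = ker_proj Z ** D ** ker_proj Z"
    and "D ** ker_proj Z = ker_proj Z ** D ** ker_proj Z"
    and "pos_proj Z ** D ** neg_proj Z = 0"
    and "D = pos_proj Z ** D ** pos_proj Z + neg_proj Z ** D ** neg_proj Z + ker_proj Z ** D ** ker_proj Z"
proof -
  define A where "A = Pi_plus Z"
  define B where "B = Pi_plus Z - Z"
  have A: "A \<in> PSD" "A \<in> Sym" "transpose A = A" and B: "B \<in> PSD" "B \<in> Sym" "transpose B = B"
    using Pi_plus_PSD[of Z] Pi_plus_residual_PSD[OF Z] by (auto simp: A_def B_def PSD_Sym SymD)
  have ZAB: "Z = A - B" by (simp add: A_def B_def)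
  have BA: "B ** A = 0" using Pi_plus_residual_mult[OF Z] by (simp add: A_def B_def)
  have AB: "A ** B = 0" using arg_cong[OF BA, of transpose] by (simp add: transpose_simps A B)
  note sp = spectral_projections[OF Z]
  have DT: "transpose D = D" by (rule SymD[OF D])
  define M where "M = A ** (D ** B)"
  have "A ** (D ** Z) ** B = - (M ** B)"
    by (simp add: ZAB M_def matrix_distribs matrix_mul_assoc) (simp add: AB flip: matrix_mul_assoc)
  moreover have "A ** (Z ** D) ** B = A ** M"
    by (simp add: ZAB M_def matrix_distribs matrix_mul_assoc AB)
  ultimately have e: "M ** B = - (A ** M)" by (simp add: comm)
  \<comment> \<open>The Sylvester equation makes this \<open>- |A ** M|^2\<close>, whereas as a
    pairing of two positive semidefinite matrices it is nonnegative.\<close>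
  have "(M ** B) \<bullet> (A ** M) = B \<bullet> (transpose M ** A ** M)"
    by (subst inner_matrix_mult_left) (simp add: matrix_mul_assoc)
  also have "\<dots> \<ge> 0"
    using PSD_congruence[OF A(1), of "transpose M"] by (intro PSD_inner_nonneg B) simp
  finally have "(A ** M) \<bullet> (A ** M) \<le> 0" by (simp add: e)
  then have "A ** M = 0" by (metis antisym inner_eq_zero_iff inner_ge_zero)
  then have "M = 0" unfolding M_def by (rule Sym_square_mult_zero[OF A(2)])
  then have "pos_proj Z ** (D ** B) = 0" unfolding M_def A_def by (rule sp(16))
  from arg_cong[OF this, of transpose] have "B ** (D ** pos_proj Z) = 0"
    by (simp add: transpose_simps DT B sp(1) matrix_mul_assoc)
  then have NDP: "neg_proj Z ** (D ** pos_proj Z) = 0" unfolding B_def by (rule sp(17))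
  from arg_cong[OF this, of transpose] show PDN: "pos_proj Z ** D ** neg_proj Z = 0"
    by (simp add: transpose_simps DT sp matrix_mul_assoc)
  have "Z ** (D ** ker_proj Z) = 0"
    by (simp add: matrix_mul_assoc flip: comm) (simp add: mult_ker_proj flip: matrix_mul_assoc)
  then have 0: "ker_proj Z ** (D ** ker_proj Z) = D ** ker_proj Z" by (rule ker_proj_absorb)
  then show D0: "D ** ker_proj Z = ker_proj Z ** D ** ker_proj Z" by (simp add: matrix_mul_assoc)
  from arg_cong[OF this, of transpose] show D0': "ker_proj Z ** D = ker_proj Z ** D ** ker_proj Z"
    by (simp add: transpose_simps DT SymD[OF ker_proj_Sym] matrix_mul_assoc)
  have PDO: "pos_proj Z ** (D ** ker_proj Z) = 0" "neg_proj Z ** (D ** ker_proj Z) = 0"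
    unfolding D0 by (simp_all add: matrix_mul_assoc sp)
  have ODP: "ker_proj Z ** D ** pos_proj Z = 0" "ker_proj Z ** D ** neg_proj Z = 0"
    by (subst D0', simp add: sp flip: matrix_mul_assoc)+
  have "D = (pos_proj Z + neg_proj Z + ker_proj Z) ** D ** (pos_proj Z + neg_proj Z + ker_proj Z)"
    by (simp add: sp(13))
  also have "\<dots> = pos_proj Z ** D ** pos_proj Z + neg_proj Z ** D ** neg_proj Z + ker_proj Z ** D ** ker_proj Z"
    using PDN NDP PDO ODP by (simp add: matrix_distribs matrix_mul_assoc)
  finally show "D = \<dots>" .
qed

text \<open>Multiplying complementarity by \<open>Q\<close> leaves \<open>Q ** X ** X = 0\<close>
  for \<open>X = Pi_plus Z\<close>, and a square of a symmetric matrix can be cancelled to a single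
  factor.\<close>

lemma Pi_plus_null_left:
  assumes Z: "Z \<in> Sym" and Q: "transpose Q = Q" "Q ** Z = 0"
  shows "Q ** Pi_plus Z = 0" "Pi_plus Z ** Q = 0"
proof -
  let ?X = "Pi_plus Z"
  have "(?X - Z) ** ?X = 0" by (rule Pi_plus_residual_mult[OF Z])
  from arg_cong[OF this, of "\<lambda>Y. Q ** Y"] have "Q ** ?X ** ?X = 0"
    by (simp add: matrix_distribs matrix_mul_assoc Q)
  from arg_cong[OF this, of transpose] have "?X ** (?X ** Q) = 0"
    by (simp add: transpose_simps SymD[OF Pi_plus_Sym] Q)
  then show 1: "?X ** Q = 0" by (rule Sym_square_mult_zero[OF Pi_plus_Sym])
  from arg_cong[OF this, of transpose] show "Q ** ?X = 0"
    by (simp add: transpose_simps SymD[OF Pi_plus_Sym] Q)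
qed

text \<open>\<open>M\<close> is block diagonal. The positive block goes to \<open>X\<close>, the
  negative one to \<open>N\<close>, and the kernel block is split by its own projection; the blocks
  are mutually orthogonal, so \<open>Pi_plus_unique\<close> applies.\<close>

lemma Pi_plus_commuting:
  fixes Z M :: "real^'n::finite^'n"
  assumes Z: "Z \<in> Sym" and M: "M \<in> Sym" "M ** Z = Z ** M"
    and pos: "pos_proj Z ** M ** pos_proj Z \<in> PSD" and neg: "neg_proj Z ** (- M) ** neg_proj Z \<in> PSD"
  shows "Pi_plus M = pos_proj Z ** M ** pos_proj Z + Pi_plus (ker_proj Z ** M ** ker_proj Z)"
proof -
  note sp = spectral_projections[OF Z]
  define R where "R = ker_proj Z ** M ** ker_proj Z"
  have R: "R \<in> Sym" using Sym_congruence[OF M(1), of "ker_proj Z"] by (simp add: R_def SymD[OF ker_proj_Sym])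
  have PR: "pos_proj Z ** R = 0" "neg_proj Z ** R = 0" "R ** pos_proj Z = 0"
    unfolding R_def by (simp_all add: matrix_mul_assoc sp) (simp add: sp flip: matrix_mul_assoc)
  have X0: "neg_proj Z ** Pi_plus R = 0" "Pi_plus R ** pos_proj Z = 0"
    using Pi_plus_null_left[OF R sp(3) PR(2)] Pi_plus_null_left[OF R sp(1) PR(1)] by simp_all
  define X where "X = pos_proj Z ** M ** pos_proj Z + Pi_plus R"
  define N where "N = neg_proj Z ** (- M) ** neg_proj Z + (Pi_plus R - R)"
  have "N ** X = 0"
    unfolding N_def X_def using X0 PR Pi_plus_residual_mult[OF R]
    by (simp add: matrix_distribs matrix_mul_assoc) (simp add: sp X0 flip: matrix_mul_assoc)
  moreover have NP: "N \<in> PSD" unfolding N_def by (intro PSD_add neg Pi_plus_residual_PSD R)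
  ultimately have "N \<bullet> X = 0" by (simp add: inner_matrix_eq_trace SymD PSD_Sym trace_0 flip: mat_0)
  moreover have "X \<in> PSD" unfolding X_def by (intro PSD_add pos Pi_plus_PSD)
  ultimately have "Pi_plus (X - N) = X" using NP by (intro Pi_plus_unique)
  moreover have "X - N = M"
    using commuting_blocks(4)[OF Z M] by (simp add: X_def N_def R_def matrix_distribs ac_simps)
  ultimately show ?thesis by (simp add: X_def R_def)
qed

section \<open>Persistence of semidefinite blocks under perturbation\<close>

lemma norm_outer: "norm (outer x) = x \<bullet> x"
proof -
  have "outer x \<bullet> outer x = (x \<bullet> x)\<^sup>2"
    by (simp add: inner_outer outer_mult power2_eq_square)
  then show ?thesis by (simp add: norm_eq_sqrt_inner)
qed

lemma quadratic_form_bound: "\<bar>(x :: real^'n) \<bullet> (B *v x)\<bar> \<le> norm B * (x \<bullet> x)"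
  using Cauchy_Schwarz_ineq2[of B "outer x"] by (simp add: inner_outer norm_outer)

lemma posdef_coercive:
  fixes A :: "real^'n^'n"
  assumes "\<And>x. x \<noteq> 0 \<Longrightarrow> x \<bullet> (A *v x) > 0"
  obtains c where "c > 0" "\<And>x. x \<bullet> (A *v x) \<ge> c * (x \<bullet> x)"
proof -
  have "continuous_on (sphere 0 1) (\<lambda>x. x \<bullet> (A *v x))"
    by (intro continuous_intros linear_continuous_on matrix_vector_mul_bounded_linear)
  moreover obtain b :: "real^'n" where "norm b = 1" using vector_choose_size[of 1] by auto
  then have "sphere (0::real^'n) 1 \<noteq> {}" by auto
  ultimately obtain u where u: "u \<in> sphere 0 1" "\<And>x. x \<in> sphere 0 1 \<Longrightarrow> u \<bullet> (A *v u) \<le> x \<bullet> (A *v x)"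
    using continuous_attains_inf[OF compact_sphere] by blast
  show thesis
  proof
    show "u \<bullet> (A *v u) > 0" using u(1) by (intro assms) auto
    fix x
    show "u \<bullet> (A *v u) * (x \<bullet> x) \<le> x \<bullet> (A *v x)"
    proof (cases "x = 0")
      case False
      define y where "y = (1 / norm x) *\<^sub>R x"
      have "u \<bullet> (A *v u) \<le> y \<bullet> (A *v y)" by (rule u(2)) (simp add: y_def False)
      also have "\<dots> = (x \<bullet> (A *v x)) / (x \<bullet> x)"
        by (simp add: y_def matrix_vector_mult_scaleR dot_square_norm power2_eq_square)
      finally show ?thesis using False by (simp add: pos_le_divide_eq)
    qed simp
  qed
qed

text \<open>Adding the kernel projection makes \<open>A\<close> positive definite, hence coercive
  with some \<open>c > 0\<close>, and a perturbation of norm below \<open>c\<close> stays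
  semidefinite. Compressing with \<open>P\<close> removes the added projection. For the later use
  \<open>L\<close> is \<open>Z\<close> or \<open>- Z\<close> and only its block is
  \<open>A\<close>.\<close>

lemma eventually_PSD_block:
  fixes A L :: "real^'n::finite^'n"
  assumes A: "A \<in> PSD" and P: "P = mat 1 - ker_proj A" and L: "P ** L ** P = A"
    and M: "\<And>t. M t \<in> Sym" "(M \<longlongrightarrow> L) F"
  shows "eventually (\<lambda>t. P ** M t ** P \<in> PSD) F"
proof -
  let ?K = "ker_proj A"
  note sp = support_proj[OF PSD_Sym[OF A] P]
  have K: "transpose ?K = ?K" "?K ** ?K = ?K" by (simp_all add: SymD[OF ker_proj_Sym] ker_proj_idem)
  have "x \<bullet> ((A + ?K) *v x) > 0" if "x \<noteq> 0" for x
  proof -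
    have e: "x \<bullet> ((A + ?K) *v x) = x \<bullet> (A *v x) + (?K *v x) \<bullet> (?K *v x)"
      using Sym_inner[OF ker_proj_Sym, of x A "?K *v x"] K(2)
      by (simp add: matrix_vector_mult_add_rdistrib inner_add_right matrix_vector_mul_assoc)
    have "x \<bullet> ((A + ?K) *v x) \<noteq> 0"
    proof
      assume "x \<bullet> ((A + ?K) *v x) = 0"
      then have 0: "x \<bullet> (A *v x) = 0" "(?K *v x) \<bullet> (?K *v x) = 0"
        using PSD_nonneg[OF A, of x] inner_ge_zero[of "?K *v x"] unfolding e by linarith+
      from PSD_null[OF A 0(1)] obtain y where "x = ?K *v y" using ker_proj_spec[of A] by blast
      then have "x = ?K *v x" by (metis K(2) matrix_vector_mul_assoc)
      with 0 that show False by simp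
    qed
    moreover have "x \<bullet> ((A + ?K) *v x) \<ge> 0" unfolding e using PSD_nonneg[OF A, of x] by simp
    ultimately show ?thesis by linarith
  qed
  then obtain c where c: "c > 0" "\<And>x. x \<bullet> ((A + ?K) *v x) \<ge> c * (x \<bullet> x)"
    using posdef_coercive by metis
  define G where "G t = P ** M t ** P + ?K" for t
  have "(G \<longlongrightarrow> P ** L ** P + ?K) F"
    unfolding G_def by (intro tendsto_add tendsto_matrix_mult tendsto_const M)
  then have "(G \<longlongrightarrow> A + ?K) F" by (simp add: L)
  from tendstoD[OF this c(1)] show ?thesis
  proof eventually_elim
    case (elim t)
    have GS: "G t \<in> Sym"
      using Sym_congruence[OF M(1)[of t], of P] by (simp add: G_def sp Sym_add ker_proj_Sym)
    have "x \<bullet> (G t *v x) \<ge> 0" for x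
    proof -
      have "\<bar>x \<bullet> ((G t - (A + ?K)) *v x)\<bar> \<le> norm (G t - (A + ?K)) * (x \<bullet> x)"
        by (rule quadratic_form_bound)
      also have "\<dots> \<le> c * (x \<bullet> x)" using elim by (intro mult_right_mono) (auto simp: dist_norm)
      finally have "\<bar>x \<bullet> ((G t - (A + ?K)) *v x)\<bar> \<le> c * (x \<bullet> x)" .
      with c(2)[of x] show ?thesis by (simp add: matrix_vector_mult_diff_rdistrib inner_diff_right)
    qed
    then have "G t \<in> PSD" using GS by (simp add: PSD_def)
    from PSD_congruence[OF this, of P] have "P ** G t ** P \<in> PSD" by (simp add: sp)
    moreover have "P ** ?K = 0" by (simp add: P matrix_distribs K)
    ultimately show ?case
      by (simp add: G_def matrix_distribs matrix_mul_assoc sp) (simp add: sp flip: matrix_mul_assoc)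
  qed
qed

text \<open>The commutator with \<open>Z\<close> is self-adjoint, so the space is the sum of its kernel and its range.\<close>
lemma commutator_decomposition:
  fixes Z H :: "real^'n::finite^'n"
  assumes Z: "Z \<in> Sym" and H: "H \<in> Sym"
  obtains D K where "D \<in> Sym" "D ** Z = Z ** D" "transpose K = - K" "H = D + (K ** Z - Z ** K)"
proof -
  define c where "c X = X ** Z - Z ** X" for X
  have "linear c" by (rule linearI) (simp_all add: c_def matrix_distribs algebra_simps)
  then have "subspace (range c)" by (simp add: linear_subspace_image)
  from subspace_sum_orthogonal_comp[OF this] have "H \<in> range c + (range c)\<^sup>\<bottom>" by simp
  then obtain K D where KD: "H = c K + D" "D \<in> (range c)\<^sup>\<bottom>" by (auto elim!: set_plus_elim)
  have adj: "c X \<bullet> Y = X \<bullet> c Y" for X Y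
    unfolding c_def inner_diff_left inner_diff_right
    by (simp add: inner_matrix_mult_right[of X Z] inner_matrix_mult_left[of Z X] SymD Z)
  have "c (c D) \<bullet> D = 0" using KD(2) by (auto simp: orthogonal_comp_def orthogonal_def)
  then have "c D \<bullet> c D = 0" by (simp only: adj)
  then have cD: "c D = 0" by simp
  have cT: "transpose (c X) = - c (transpose X)" for X
    by (simp add: c_def transpose_simps SymD Z)
  have cl: "c (X + Y) = c X + c Y" "c (r *\<^sub>R X) = r *\<^sub>R c X" "c (X - Y) = c X - c Y" for X Y r
    by (simp_all add: c_def matrix_distribs algebra_simps)
  \<comment> \<open>Transposition anticommutes with \<open>c\<close>, so averaging \<open>H\<close>
    with its transpose symmetrizes \<open>D\<close> and antisymmetrizes \<open>K\<close>.\<close>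
  define D' where "D' = (1/2) *\<^sub>R (D + transpose D)"
  define K' where "K' = (1/2) *\<^sub>R (K - transpose K)"
  have cDT: "c (transpose D) = 0" using cT[of D] cD by (simp add: transpose_zero)
  have "D' + c K' = (1/2) *\<^sub>R (H + transpose H)"
    by (simp add: D'_def K'_def cl KD(1) transpose_add cT algebra_simps)
  also have "\<dots> = H" using H by (simp add: SymD flip: scaleR_2)
  finally have "H = D' + (K' ** Z - Z ** K')" by (simp add: c_def)
  moreover have "D' \<in> Sym" by (simp add: D'_def Sym_def transpose_simps add.commute)
  moreover have "c D' = 0" by (simp add: D'_def cl cD cDT)
  then have "D' ** Z = Z ** D'" by (simp add: c_def)
  moreover have "transpose K' = - K'" by (simp add: K'_def transpose_simps flip: scaleR_minus_right)
  ultimately show thesis using that by blast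
qed

section \<open>Second-order expansion of the projection\<close>

text \<open>One-sided second-order expansion \<open>f t = a + t b + (t\<^sup>2/2) c + o(t\<^sup>2)\<close>, scaled like the quotient in \<open>dir2\<close>.\<close>
definition jet2 :: "(real \<Rightarrow> 'a::real_normed_vector) \<Rightarrow> 'a \<Rightarrow> 'a \<Rightarrow> 'a \<Rightarrow> bool" where
  "jet2 f a b c \<longleftrightarrow> ((\<lambda>t. (1 / (t\<^sup>2 / 2)) *\<^sub>R (f t - a - t *\<^sub>R b)) \<longlongrightarrow> c) (at_right 0)"

section \<open>Calculus of second-order expansions\<close>

lemma eventually_pos_at_right: "eventually (\<lambda>t::real. t > 0) (at_right 0)"
  by (simp add: eventually_at_right_less)

lemma jet2I:
  assumes "eventually (\<lambda>t. f t = a + t *\<^sub>R b + (t\<^sup>2 / 2) *\<^sub>R q t) (at_right 0)" "(q \<longlongrightarrow> c) (at_right 0)"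
  shows "jet2 f a b c"
  unfolding jet2_def
proof (rule Lim_transform_eventually[OF assms(2)])
  show "eventually (\<lambda>t. q t = (1 / (t\<^sup>2 / 2)) *\<^sub>R (f t - a - t *\<^sub>R b)) (at_right 0)"
    using assms(1) eventually_pos_at_right by eventually_elim simp
qed

lemma jet2E:
  assumes "jet2 f a b c"
  obtains q where "(q \<longlongrightarrow> c) (at_right 0)"
    "eventually (\<lambda>t. f t = a + t *\<^sub>R b + (t\<^sup>2 / 2) *\<^sub>R q t) (at_right 0)"
proof
  show "((\<lambda>t. (1 / (t\<^sup>2 / 2)) *\<^sub>R (f t - a - t *\<^sub>R b)) \<longlongrightarrow> c) (at_right 0)"
    using assms by (simp add: jet2_def)
  show "eventually (\<lambda>t. f t = a + t *\<^sub>R b + (t\<^sup>2 / 2) *\<^sub>R ((1 / (t\<^sup>2 / 2)) *\<^sub>R (f t - a - t *\<^sub>R b))) (at_right 0)"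
    using eventually_pos_at_right by eventually_elim simp
qed

lemma tendsto_at_right_id: "((\<lambda>t::real. t) \<longlongrightarrow> 0) (at_right 0)"
  by (rule tendsto_ident_at)

lemma jet2_quadratic: "jet2 (\<lambda>t. a + t *\<^sub>R b + (t\<^sup>2 / 2) *\<^sub>R c) a b c"
  by (rule jet2I[of _ _ _ "\<lambda>_. c"]) simp_all

lemma jet2_const: "jet2 (\<lambda>t. a) a 0 0"
  by (rule jet2I[of _ _ _ "\<lambda>_. 0"]) simp_all

lemma jet2_add:
  assumes "jet2 f a b c" "jet2 g a' b' c'"
  shows "jet2 (\<lambda>t. f t + g t) (a + a') (b + b') (c + c')"
proof -
  have e: "f t + g t - (a + a') - t *\<^sub>R (b + b') = (f t - a - t *\<^sub>R b) + (g t - a' - t *\<^sub>R b')" for t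
    by (simp add: scaleR_right_distrib)
  show ?thesis
    using tendsto_add[OF assms[unfolded jet2_def]] unfolding jet2_def e by (simp only: scaleR_right_distrib)
qed

lemma jet2_linear:
  assumes "bounded_linear h" "jet2 f a b c"
  shows "jet2 (\<lambda>t. h (f t)) (h a) (h b) (h c)"
proof -
  interpret bounded_linear h by fact
  show ?thesis
    using tendsto[OF assms(2)[unfolded jet2_def]] unfolding jet2_def by (simp add: scaleR diff)
qed

lemma jet2_uminus: "jet2 f a b c \<Longrightarrow> jet2 (\<lambda>t. - f t) (- a) (- b) (- c)"
  by (rule jet2_linear[OF bounded_linear_minus[OF bounded_linear_ident]])

lemma jet2_diff:
  assumes "jet2 f a b c" "jet2 g a' b' c'"
  shows "jet2 (\<lambda>t. f t - g t) (a - a') (b - b') (c - c')"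
  using jet2_add[OF assms(1) jet2_uminus[OF assms(2)]] by simp

lemma jet2_mult:
  fixes f g :: "real \<Rightarrow> real^'n^'n"
  assumes "jet2 f a b c" "jet2 g a' b' c'"
  shows "jet2 (\<lambda>t. f t ** g t) (a ** a') (a ** b' + b ** a') (a ** c' + 2 *\<^sub>R (b ** b') + c ** a')"
proof -
  obtain q where q: "(q \<longlongrightarrow> c) (at_right 0)"
    "eventually (\<lambda>t. f t = a + t *\<^sub>R b + (t\<^sup>2 / 2) *\<^sub>R q t) (at_right 0)"
    using jet2E[OF assms(1)] .
  obtain q' where q': "(q' \<longlongrightarrow> c') (at_right 0)"
    "eventually (\<lambda>t. g t = a' + t *\<^sub>R b' + (t\<^sup>2 / 2) *\<^sub>R q' t) (at_right 0)"
    using jet2E[OF assms(2)] .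
  \<comment> \<open>The exact remainder of the product divided by \<open>t\<^sup>2 / 2\<close>; the
    factor 2 at \<open>b ** b'\<close> comes from this scaling.\<close>
  define p where "p t = a ** q' t + 2 *\<^sub>R (b ** b') + q t ** a' + t *\<^sub>R (b ** q' t + q t ** b')
    + (t\<^sup>2 / 2) *\<^sub>R (q t ** q' t)" for t
  have "(p \<longlongrightarrow> a ** c' + 2 *\<^sub>R (b ** b') + c ** a' + 0 *\<^sub>R (b ** c' + c ** b') + (0\<^sup>2 / 2) *\<^sub>R (c ** c')) (at_right 0)"
    unfolding p_def by (intro tendsto_add tendsto_scaleR tendsto_matrix_mult tendsto_const q q' tendsto_at_right_id
      tendsto_divide tendsto_power) simp
  then have p: "(p \<longlongrightarrow> a ** c' + 2 *\<^sub>R (b ** b') + c ** a') (at_right 0)" by simp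
  show ?thesis
  proof (rule jet2I[OF _ p])
    show "eventually (\<lambda>t. f t ** g t = a ** a' + t *\<^sub>R (a ** b' + b ** a') + (t\<^sup>2 / 2) *\<^sub>R p t) (at_right 0)"
      using q(2) q'(2)
      by eventually_elim (simp add: p_def matrix_distribs scaleR_right_distrib power2_eq_square mult.assoc)
  qed
qed

lemma jet2_tendsto_deriv:
  assumes "jet2 f a b c"
  shows "((\<lambda>t. (1 / t) *\<^sub>R (f t - a)) \<longlongrightarrow> b) (at_right 0)"
proof -
  obtain q where q: "(q \<longlongrightarrow> c) (at_right 0)"
    "eventually (\<lambda>t. f t = a + t *\<^sub>R b + (t\<^sup>2 / 2) *\<^sub>R q t) (at_right 0)"
    using jet2E[OF assms] .
  have "((\<lambda>t. b + (t / 2) *\<^sub>R q t) \<longlongrightarrow> b + (0 / 2) *\<^sub>R c) (at_right 0)"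
    by (intro tendsto_add tendsto_scaleR tendsto_const q tendsto_at_right_id tendsto_divide) simp
  then have "((\<lambda>t. b + (t / 2) *\<^sub>R q t) \<longlongrightarrow> b) (at_right 0)" by simp
  then show ?thesis
  proof (rule Lim_transform_eventually)
    show "eventually (\<lambda>t. b + (t / 2) *\<^sub>R q t = (1 / t) *\<^sub>R (f t - a)) (at_right 0)"
      using q(2) eventually_pos_at_right
      by eventually_elim (simp add: scaleR_right_distrib power2_eq_square)
  qed
qed

lemma jet2_tendsto:
  assumes "jet2 f a b c"
  shows "(f \<longlongrightarrow> a) (at_right 0)"
proof -
  have "((\<lambda>t. a + t *\<^sub>R ((1 / t) *\<^sub>R (f t - a))) \<longlongrightarrow> a + 0 *\<^sub>R b) (at_right 0)"
    by (intro tendsto_add tendsto_scaleR tendsto_const tendsto_at_right_id jet2_tendsto_deriv[OF assms])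
  then have "((\<lambda>t. a + t *\<^sub>R ((1 / t) *\<^sub>R (f t - a))) \<longlongrightarrow> a) (at_right 0)" by simp
  then show ?thesis
    by (rule Lim_transform_eventually) (use eventually_pos_at_right in \<open>eventually_elim, simp\<close>)
qed

lemma jet2_zero_iff: "jet2 f 0 0 0 \<longleftrightarrow> ((\<lambda>t. (1 / (t\<^sup>2 / 2)) *\<^sub>R f t) \<longlongrightarrow> 0) (at_right 0)"
  by (simp add: jet2_def)

section \<open>Stability of the projection under small errors and almost orthogonal
  conjugation\<close>

lemma jet2_Pi_plus_perturb:
  assumes "jet2 (\<lambda>t. f t - g t) 0 0 0"
  shows "jet2 (\<lambda>t. Pi_plus (f t) - Pi_plus (g t)) 0 0 0"
  unfolding jet2_zero_iff
proof (rule Lim_null_comparison)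
  show "((\<lambda>t. norm ((1 / (t\<^sup>2 / 2)) *\<^sub>R (f t - g t))) \<longlongrightarrow> 0) (at_right 0)"
    using assms unfolding jet2_zero_iff by (rule tendsto_norm_zero)
  show "eventually (\<lambda>t. norm ((1 / (t\<^sup>2 / 2)) *\<^sub>R (Pi_plus (f t) - Pi_plus (g t)))
      \<le> norm ((1 / (t\<^sup>2 / 2)) *\<^sub>R (f t - g t))) (at_right 0)"
    unfolding norm_scaleR by (intro always_eventually allI mult_left_mono Pi_plus_lipschitz) simp
qed

text \<open>If \<open>A \<bullet> B = 0\<close>, then \<open>A\<close> is the projection of
  \<open>A - B\<close>; in general the pairing bounds the squared error. With \<open>X\<close> the
  projection and \<open>N\<close> its residual, \<open>X - A = N - B\<close>, and expanding gives
  \<open>A \<bullet> B\<close> minus two nonnegative pairings.\<close>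

lemma Pi_plus_near_splitting:
  fixes A B :: "real^'n::finite^'n"
  assumes A: "A \<in> PSD" and B: "B \<in> PSD"
  shows "(norm (Pi_plus (A - B) - A))\<^sup>2 \<le> A \<bullet> B"
proof -
  define X where "X = Pi_plus (A - B)"
  define N where "N = X - (A - B)"
  have S: "A - B \<in> Sym" by (intro Sym_diff PSD_Sym A B)
  have N: "N \<in> PSD" unfolding N_def X_def by (rule Pi_plus_residual_PSD[OF S])
  have X: "X \<in> PSD" by (simp add: X_def Pi_plus_PSD)
  have NX: "N \<bullet> X = 0" unfolding N_def X_def by (rule Pi_plus_residual_inner)
  have XA: "X - A = N - B" by (simp add: N_def)
  have "(norm (X - A))\<^sup>2 = (X - A) \<bullet> (N - B)"
    unfolding power2_norm_eq_inner by (simp add: XA)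
  also have "\<dots> = A \<bullet> B - X \<bullet> B - A \<bullet> N"
    using NX by (simp add: inner_diff_left inner_diff_right inner_commute)
  also have "\<dots> \<le> A \<bullet> B" using PSD_inner_nonneg[OF X B] PSD_inner_nonneg[OF A N] by linarith
  finally show ?thesis by (simp add: X_def)
qed

text \<open>In the pairing of the two conjugated parts the terms of order zero and one in
  \<open>E\<close> vanish by complementarity. The squared error is therefore quadratic in
  \<open>E\<close>, so the error is of the order of \<open>E\<close> itself.\<close>

lemma Pi_plus_almost_orthogonal:
  fixes M U :: "real^'n::finite^'n"
  assumes M: "M \<in> Sym" and E: "transpose U ** U = mat 1 + E"
  shows "(norm (Pi_plus (U ** M ** transpose U) - U ** Pi_plus M ** transpose U))\<^sup>2
    \<le> Pi_plus M \<bullet> (E ** (Pi_plus M - M) ** E)"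
proof -
  define X N where "X = Pi_plus M" and "N = Pi_plus M - M"
  have X: "X \<in> PSD" "transpose X = X" and N: "N \<in> PSD" "transpose N = N"
    using Pi_plus_PSD[of M] Pi_plus_residual_PSD[OF M] by (auto simp: X_def N_def PSD_Sym SymD)
  have NX: "N ** X = 0" using Pi_plus_residual_mult[OF M] by (simp add: X_def N_def)
  have XN: "X ** N = 0" using arg_cong[OF NX, of transpose] by (simp add: transpose_simps X N)
  have "U ** M ** transpose U = U ** X ** transpose U - U ** N ** transpose U"
    by (simp add: X_def N_def matrix_distribs)
  then have "(norm (Pi_plus (U ** M ** transpose U) - U ** X ** transpose U))\<^sup>2
      \<le> (U ** X ** transpose U) \<bullet> (U ** N ** transpose U)"
    using Pi_plus_near_splitting[OF PSD_congruence[OF X(1), of U] PSD_congruence[OF N(1), of U]] by simp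
  also have "\<dots> = X \<bullet> ((transpose U ** U) ** N ** (transpose U ** U))"
    by (subst inner_matrix_mult_right, subst inner_matrix_mult_left) (simp add: matrix_mul_assoc)
  also have "\<dots> = X \<bullet> N + X \<bullet> (E ** N) + X \<bullet> (N ** E) + X \<bullet> (E ** N ** E)"
    by (simp add: E matrix_distribs inner_add_right)
  also have "X \<bullet> N = 0" by (simp add: inner_matrix_eq_trace X XN trace_0 flip: mat_0)
  also have "X \<bullet> (N ** E) = 0"
    by (subst inner_commute, subst inner_matrix_mult_left) (simp add: N NX)
  also have "X \<bullet> (E ** N) = 0"
    by (subst inner_commute, subst inner_matrix_mult_right) (simp add: N XN)
  finally show ?thesis by (simp add: X_def N_def)
qed

lemma jet2_Pi_plus_conj:
  fixes M U :: "real \<Rightarrow> real^'n::finite^'n"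
  assumes M: "\<And>t. M t \<in> Sym" "(M \<longlongrightarrow> Z) (at_right 0)"
    and U: "jet2 (\<lambda>t. transpose (U t) ** U t) (mat 1) 0 0"
  shows "jet2 (\<lambda>t. Pi_plus (U t ** M t ** transpose (U t)) - U t ** Pi_plus (M t) ** transpose (U t)) 0 0 0"
proof -
  define E where "E t = transpose (U t) ** U t - mat 1" for t
  have "jet2 E 0 0 0" using jet2_diff[OF U jet2_const[of "mat 1"]] by (simp add: E_def[abs_def])
  then have E: "((\<lambda>t. (1 / (t\<^sup>2 / 2)) *\<^sub>R E t) \<longlongrightarrow> 0) (at_right 0)" by (simp add: jet2_zero_iff)
  have lip: "norm (Pi_plus (M t) - Pi_plus Z) \<le> norm (M t - Z)" for t by (rule Pi_plus_lipschitz)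
  have PM: "((\<lambda>t. Pi_plus (M t)) \<longlongrightarrow> Pi_plus Z) (at_right 0)"
    by (rule LIM_zero_cancel, rule Lim_null_comparison[OF _ tendsto_norm_zero[OF LIM_zero[OF M(2)]]])
      (simp add: lip)
  define r where "r t = (1 / (t\<^sup>2 / 2)) *\<^sub>R (Pi_plus (U t ** M t ** transpose (U t)) - U t ** Pi_plus (M t) ** transpose (U t))" for t
  \<comment> \<open>The bound on the squared error, with one factor
    \<open>1 / (t\<^sup>2 / 2)\<close> given to each \<open>E t\<close>.\<close>
  define h where "h t = Pi_plus (M t) \<bullet> (((1 / (t\<^sup>2 / 2)) *\<^sub>R E t) ** (Pi_plus (M t) - M t) ** ((1 / (t\<^sup>2 / 2)) *\<^sub>R E t))" for t
  have "(h \<longlongrightarrow> Pi_plus Z \<bullet> (0 ** (Pi_plus Z - Z) ** 0)) (at_right 0)"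
    unfolding h_def by (intro tendsto_inner tendsto_matrix_mult tendsto_diff PM E M)
  then have h: "(h \<longlongrightarrow> 0) (at_right 0)" by simp
  have rh: "(norm (r t))\<^sup>2 \<le> h t" for t
  proof -
    have "(norm (r t))\<^sup>2 = (1 / (t\<^sup>2 / 2))\<^sup>2 *
        (norm (Pi_plus (U t ** M t ** transpose (U t)) - U t ** Pi_plus (M t) ** transpose (U t)))\<^sup>2"
      by (simp only: r_def norm_scaleR power_mult_distrib power2_abs)
    also have "\<dots> \<le> (1 / (t\<^sup>2 / 2))\<^sup>2 * (Pi_plus (M t) \<bullet> (E t ** (Pi_plus (M t) - M t) ** E t))"
      by (intro mult_left_mono Pi_plus_almost_orthogonal M) (simp_all add: E_def)
    also have "\<dots> = h t"
      by (simp only: h_def matrix_scaleR_left matrix_scaleR_right inner_scaleR_right scaleR_scaleR power2_eq_square mult.assoc)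
    finally show ?thesis .
  qed
  have "((\<lambda>t. (norm (r t))\<^sup>2) \<longlongrightarrow> 0) (at_right 0)"
    by (rule tendsto_sandwich[OF _ _ tendsto_const h]) (simp_all add: rh)
  from tendsto_real_sqrt[OF this] have "((\<lambda>t. norm (r t)) \<longlongrightarrow> 0) (at_right 0)"
    by (simp only: real_sqrt_abs real_sqrt_zero abs_norm_cancel)
  then have "(r \<longlongrightarrow> 0) (at_right 0)" by (rule tendsto_norm_zero_cancel)
  then show ?thesis by (simp only: jet2_zero_iff r_def[abs_def])
qed

text \<open>Second-order truncation of \<open>exp (t K1 + (t\<^sup>2/2) K2)\<close>; orthogonal up to \<open>O(t\<^sup>3)\<close> for skew \<open>K1\<close>, \<open>K2\<close>.\<close>
definition rot :: "real^'n^'n \<Rightarrow> real^'n^'n \<Rightarrow> real \<Rightarrow> real^'n^'n" where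
  "rot K1 K2 t = mat 1 + t *\<^sub>R K1 + (t\<^sup>2 / 2) *\<^sub>R (K2 + K1 ** K1)"

lemma jet2_rot: "jet2 (rot K1 K2) (mat 1) K1 (K2 + K1 ** K1)"
  using jet2_quadratic[of "mat 1" K1 "K2 + K1 ** K1"] by (simp add: rot_def[abs_def])

lemma jet2_transpose_rot:
  assumes "transpose K1 = - K1" "transpose K2 = - K2"
  shows "jet2 (\<lambda>t. transpose (rot K1 K2 t)) (mat 1) (- K1) (- K2 + K1 ** K1)"
  using jet2_linear[OF bounded_linear_transpose jet2_rot, of K1 K2]
  by (simp add: transpose_simps assms matrix_distribs)

lemma jet2_rot_orthogonal:
  assumes "transpose K1 = - K1" "transpose K2 = - K2"
  shows "jet2 (\<lambda>t. transpose (rot K1 K2 t) ** rot K1 K2 t) (mat 1) 0 0"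
  using jet2_mult[OF jet2_transpose_rot[OF assms] jet2_rot[of K1 K2]]
  by (simp add: matrix_distribs scaleR_2)

text \<open>The product rule for conjugation by the truncated exponential; the last bracket is the
  double commutator of \<open>K1\<close> with \<open>a\<close>.\<close>

lemma jet2_rot_conj:
  assumes K: "transpose K1 = - K1" "transpose K2 = - K2" and f: "jet2 f a b c"
  shows "jet2 (\<lambda>t. rot K1 K2 t ** f t ** transpose (rot K1 K2 t)) a (b + (K1 ** a - a ** K1))
    (c + 2 *\<^sub>R (K1 ** b - b ** K1) + (K2 ** a - a ** K2)
      + (K1 ** K1 ** a - 2 *\<^sub>R (K1 ** a ** K1) + a ** K1 ** K1))"
proof -
  have e: "- (a ** K1) + (b + K1 ** a) = b + (K1 ** a - a ** K1)" by simp
  show ?thesis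
    using jet2_mult[OF jet2_mult[OF jet2_rot f] jet2_transpose_rot[OF K]]
    by (simp add: matrix_distribs matrix_mul_assoc scaleR_right_diff_distrib scaleR_right_distrib)
      (simp add: algebra_simps)
qed

text \<open>The limit \<open>q\<close> on the kernel block is kept as a hypothesis. With
  \<open>D2 = 0\<close> it is trivially zero, which yields first derivatives; these then provide
  \<open>q\<close> in general.\<close>

lemma jet2_Pi_plus_expansion:
  fixes Z D1 D2 K1 K2 :: "real^'n::finite^'n"
  assumes Z: "Z \<in> Sym" and D1: "D1 \<in> Sym" "D1 ** Z = Z ** D1" and D2: "D2 \<in> Sym" "D2 ** Z = Z ** D2"
    and K: "transpose K1 = - K1" "transpose K2 = - K2"
    and R: "R = ker_proj Z"
    and q: "((\<lambda>t. (1 / (t / 2)) *\<^sub>R (Pi_plus (R ** D1 ** R + (t / 2) *\<^sub>R (R ** D2 ** R)) - Pi_plus (R ** D1 ** R)))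
      \<longlongrightarrow> q) (at_right 0)"
    and H: "H = D1 + (K1 ** Z - Z ** K1)"
    and W: "W = D2 + 2 *\<^sub>R (K1 ** D1 - D1 ** K1) + (K2 ** Z - Z ** K2)
      + (K1 ** K1 ** Z - 2 *\<^sub>R (K1 ** Z ** K1) + Z ** K1 ** K1)"
    and G: "G = pos_proj Z ** D1 ** pos_proj Z + Pi_plus (R ** D1 ** R)"
  shows "jet2 (\<lambda>t. Pi_plus (Z + t *\<^sub>R H + (t\<^sup>2 / 2) *\<^sub>R W)) (Pi_plus Z)
    (G + (K1 ** Pi_plus Z - Pi_plus Z ** K1))
    (pos_proj Z ** D2 ** pos_proj Z + q + 2 *\<^sub>R (K1 ** G - G ** K1) + (K2 ** Pi_plus Z - Pi_plus Z ** K2)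
      + (K1 ** K1 ** Pi_plus Z - 2 *\<^sub>R (K1 ** Pi_plus Z ** K1) + Pi_plus Z ** K1 ** K1))"
proof -
  define P where "P = pos_proj Z"
  define M where "M t = Z + t *\<^sub>R D1 + (t\<^sup>2 / 2) *\<^sub>R D2" for t
  define U where "U = rot K1 K2"
  note sp = spectral_projections[OF Z]
  have RS: "transpose R = R" by (simp add: R SymD ker_proj_Sym)
  have M: "M t \<in> Sym" "M t ** Z = Z ** M t" for t
    by (simp_all add: M_def Sym_add Sym_scaleR Z D1 D2 matrix_distribs)
  have jM: "jet2 M Z D1 D2" unfolding M_def by (rule jet2_quadratic)
  note Mlim = jet2_tendsto[OF jM]
  have pos: "eventually (\<lambda>t. P ** M t ** P \<in> PSD) (at_right 0)"
    unfolding P_def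
    by (rule eventually_PSD_block[OF Pi_plus_PSD[of Z] pos_proj_def sp(5) M(1) Mlim])
  have neg: "eventually (\<lambda>t. neg_proj Z ** (- M t) ** neg_proj Z \<in> PSD) (at_right 0)"
    by (rule eventually_PSD_block[OF Pi_plus_residual_PSD[OF Z] neg_proj_def sp(6) Sym_uminus[OF M(1)] tendsto_minus[OF Mlim]])
  have RZ: "R ** Z = 0" by (simp add: R ker_proj_mult Z)
  define Q where "Q t = P ** D2 ** P
    + (1 / (t / 2)) *\<^sub>R (Pi_plus (R ** D1 ** R + (t / 2) *\<^sub>R (R ** D2 ** R)) - Pi_plus (R ** D1 ** R))" for t
  have PZP: "P ** Z ** P = Pi_plus Z" using sp(5) by (simp add: P_def)
  have ev: "eventually (\<lambda>t. Pi_plus (M t) = Pi_plus Z + t *\<^sub>R G + (t\<^sup>2 / 2) *\<^sub>R Q t) (at_right 0)"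
    using pos neg eventually_pos_at_right
  proof eventually_elim
    case (elim t)
    have RD: "R ** D1 ** R \<in> Sym" "R ** D2 ** R \<in> Sym"
      using Sym_congruence[OF D1(1), of R] Sym_congruence[OF D2(1), of R] by (simp_all add: RS)
    have "Pi_plus (M t) = P ** M t ** P + Pi_plus (R ** M t ** R)"
      unfolding P_def R by (rule Pi_plus_commuting[OF Z M]) (use elim in \<open>simp_all add: P_def\<close>)
    \<comment> \<open>Since \<open>R ** Z = 0\<close>, a factor \<open>t\<close> comes out and
      homogeneity pulls it through the projection. What remains is a first-order increment with step
      \<open>t / 2\<close>.\<close>
    also have "R ** M t ** R = t *\<^sub>R (R ** D1 ** R + (t / 2) *\<^sub>R (R ** D2 ** R))"
      by (simp add: M_def matrix_distribs RZ scaleR_right_distrib power2_eq_square)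
    also have "Pi_plus \<dots> = t *\<^sub>R Pi_plus (R ** D1 ** R + (t / 2) *\<^sub>R (R ** D2 ** R))"
      by (rule Pi_plus_scaleR) (use elim RD in \<open>auto intro!: Sym_add Sym_scaleR\<close>)
    finally show ?case using elim(3)
      by (simp add: M_def Q_def G matrix_distribs PZP P_def[symmetric] scaleR_right_distrib
          scaleR_right_diff_distrib power2_eq_square)
  qed
  have Qlim: "(Q \<longlongrightarrow> P ** D2 ** P + q) (at_right 0)"
    unfolding Q_def by (intro tendsto_add tendsto_const q)
  have jPM: "jet2 (\<lambda>t. Pi_plus (M t)) (Pi_plus Z) G (P ** D2 ** P + q)"
    by (rule jet2I[OF ev Qlim])
  have jY: "jet2 (\<lambda>t. U t ** M t ** transpose (U t)) Z H W"
    unfolding U_def H W by (rule jet2_rot_conj[OF K jM])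
  have "jet2 (\<lambda>t. (Z + t *\<^sub>R H + (t\<^sup>2 / 2) *\<^sub>R W) - U t ** M t ** transpose (U t)) 0 0 0"
    using jet2_diff[OF jet2_quadratic[of Z H W] jY] by simp
  from jet2_Pi_plus_perturb[OF this]
  have j1: "jet2 (\<lambda>t. Pi_plus (Z + t *\<^sub>R H + (t\<^sup>2 / 2) *\<^sub>R W) - Pi_plus (U t ** M t ** transpose (U t))) 0 0 0" .
  have j2: "jet2 (\<lambda>t. Pi_plus (U t ** M t ** transpose (U t)) - U t ** Pi_plus (M t) ** transpose (U t)) 0 0 0"
    by (rule jet2_Pi_plus_conj[OF M(1) Mlim]) (simp add: U_def jet2_rot_orthogonal K)
  have j3: "jet2 (\<lambda>t. U t ** Pi_plus (M t) ** transpose (U t)) (Pi_plus Z) (G + (K1 ** Pi_plus Z - Pi_plus Z ** K1))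
    (P ** D2 ** P + q + 2 *\<^sub>R (K1 ** G - G ** K1) + (K2 ** Pi_plus Z - Pi_plus Z ** K2)
      + (K1 ** K1 ** Pi_plus Z - 2 *\<^sub>R (K1 ** Pi_plus Z ** K1) + Pi_plus Z ** K1 ** K1))"
    unfolding U_def by (rule jet2_rot_conj[OF K jPM])
  \<comment> \<open>The three expansions telescope: replacing the curve by its conjugated form and
    moving the conjugation out of the projection both cost only \<open>o(t\<^sup>2)\<close>.\<close>
  from jet2_add[OF jet2_add[OF j1 j2] j3] show ?thesis by (simp add: P_def)
qed

section \<open>Directional derivatives\<close>

lemma tendsto_dir1_Pi_plus_blocks:
  fixes Z D K :: "real^'n::finite^'n"
  assumes Z: "Z \<in> Sym" and D: "D \<in> Sym" "D ** Z = Z ** D" and K: "transpose K = - K"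
    and H: "H = D + (K ** Z - Z ** K)"
  shows "((\<lambda>t. (1 / t) *\<^sub>R (Pi_plus (Z + t *\<^sub>R H) - Pi_plus Z)) \<longlongrightarrow>
    pos_proj Z ** D ** pos_proj Z + Pi_plus (ker_proj Z ** D ** ker_proj Z)
      + (K ** Pi_plus Z - Pi_plus Z ** K)) (at_right 0)" (is "(?f \<longlongrightarrow> ?L) _")
proof -
  \<comment> \<open>The second-order term produced by the rotation for \<open>D2 = K2 = 0\<close>.
    Dropping it from the argument changes the first-order quotient by at most
    \<open>t / 2 * norm W\<close>.\<close>
  define W where "W = 0 + 2 *\<^sub>R (K ** D - D ** K) + (0 ** Z - Z ** 0)
      + (K ** K ** Z - 2 *\<^sub>R (K ** Z ** K) + Z ** K ** K)"
  define g where "g t = (1 / t) *\<^sub>R (Pi_plus (Z + t *\<^sub>R H + (t\<^sup>2 / 2) *\<^sub>R W) - Pi_plus Z)" for t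
  have "(g \<longlongrightarrow> ?L) (at_right 0)"
    unfolding g_def
    by (rule jet2_tendsto_deriv, rule jet2_Pi_plus_expansion[OF Z D _ _ K _ refl _ H W_def refl, of 0])
      (simp_all add: subspace_0[OF subspace_Sym] transpose_zero)
  moreover have "((\<lambda>t. ?f t - g t) \<longlongrightarrow> 0) (at_right 0)"
  proof (rule Lim_null_comparison)
    show "eventually (\<lambda>t. norm (?f t - g t) \<le> t / 2 * norm W) (at_right 0)"
      using eventually_pos_at_right
    proof eventually_elim
      case (elim t)
      have "?f t - g t = (1 / t) *\<^sub>R (Pi_plus (Z + t *\<^sub>R H) - Pi_plus (Z + t *\<^sub>R H + (t\<^sup>2 / 2) *\<^sub>R W))"
        unfolding g_def by (simp flip: scaleR_diff_right)
      also have "norm \<dots> \<le> (1 / t) * norm ((t\<^sup>2 / 2) *\<^sub>R W)"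
        using mult_left_mono[OF Pi_plus_lipschitz[of "Z + t *\<^sub>R H" "Z + t *\<^sub>R H + (t\<^sup>2 / 2) *\<^sub>R W"], of "1 / t"] elim
        by simp
      also have "\<dots> = t / 2 * norm W" using elim by (simp add: power2_eq_square)
      finally show ?case .
    qed
    have "((\<lambda>t. t / 2 * norm W) \<longlongrightarrow> 0 / 2 * norm W) (at_right 0)"
      by (intro tendsto_mult tendsto_divide tendsto_const tendsto_at_right_id) simp
    then show "((\<lambda>t. t / 2 * norm W) \<longlongrightarrow> 0) (at_right 0)" by simp
  qed
  ultimately have "((\<lambda>t. g t + (?f t - g t)) \<longlongrightarrow> ?L + 0) (at_right 0)" by (rule tendsto_add)
  then show ?thesis by simp
qed

lemma dir1_eqI:
  "((\<lambda>t. (1 / t) *\<^sub>R (F (Z + t *\<^sub>R H) - F Z)) \<longlongrightarrow> L) (at_right 0) \<Longrightarrow> dir1 F Z H = L"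
  unfolding dir1_def by (rule tendsto_Lim) simp_all

lemma dir2_eqI: "jet2 (\<lambda>t. F (Z + t *\<^sub>R H + (t\<^sup>2 / 2) *\<^sub>R W)) (F Z) (dir1 F Z H) L \<Longrightarrow> dir2 F Z H W = L"
  unfolding dir2_def jet2_def by (rule tendsto_Lim) simp_all

lemma tendsto_dir1_Pi_plus:
  fixes Z H :: "real^'n::finite^'n"
  assumes Z: "Z \<in> Sym" and H: "H \<in> Sym"
  shows "((\<lambda>t. (1 / t) *\<^sub>R (Pi_plus (Z + t *\<^sub>R H) - Pi_plus Z)) \<longlongrightarrow> dir1 Pi_plus Z H) (at_right 0)"
proof -
  obtain D K where "D \<in> Sym" "D ** Z = Z ** D" "transpose K = - K" "H = D + (K ** Z - Z ** K)"
    using commutator_decomposition[OF assms] by metis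
  note lim = tendsto_dir1_Pi_plus_blocks[OF Z this]
  show ?thesis using lim unfolding dir1_eqI[OF lim] .
qed

lemma filterlim_mult_at_right: "c > 0 \<Longrightarrow> filterlim (\<lambda>t::real. c * t) (at_right 0) (at_right 0)"
  by (rule filterlim_times_pos[of "\<lambda>t. t" 0, OF filterlim_ident]) simp_all

lemma dir1_0: "dir1 F Z 0 = 0"
  by (rule dir1_eqI) simp

lemma dir1_Pi_plus_scaleR:
  fixes Z H :: "real^'n::finite^'n"
  assumes Z: "Z \<in> Sym" and H: "H \<in> Sym" and c: "c \<ge> 0"
  shows "dir1 Pi_plus Z (c *\<^sub>R H) = c *\<^sub>R dir1 Pi_plus Z H"
proof (cases "c = 0")
  case False
  with c have c: "c > 0" by simp
  have "((\<lambda>t. c *\<^sub>R ((1 / (c * t)) *\<^sub>R (Pi_plus (Z + (c * t) *\<^sub>R H) - Pi_plus Z))) \<longlongrightarrow> c *\<^sub>R dir1 Pi_plus Z H) (at_right 0)"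
    by (intro tendsto_scaleR tendsto_const filterlim_compose[OF tendsto_dir1_Pi_plus[OF Z H] filterlim_mult_at_right[OF c]])
  then show ?thesis using c by (intro dir1_eqI) (simp add: mult.commute)
qed (simp add: dir1_0)

text \<open>The open limit is the derivative of \<open>Pi_plus\<close> at the kernel block of
  \<open>D1\<close>, after substituting \<open>t / 2\<close>. Terms depending only on
  \<open>Z\<close>, \<open>D1\<close> and \<open>K1\<close> stand last, since they cancel in
  \<open>Theta\<close>.\<close>

lemma jet2_dir2_Pi_plus_blocks:
  fixes Z D1 D2 K1 K2 :: "real^'n::finite^'n"
  assumes Z: "Z \<in> Sym" and D1: "D1 \<in> Sym" "D1 ** Z = Z ** D1" and D2: "D2 \<in> Sym" "D2 ** Z = Z ** D2"
    and K: "transpose K1 = - K1" "transpose K2 = - K2"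
    and R: "R = ker_proj Z"
    and H: "H = D1 + (K1 ** Z - Z ** K1)"
    and W: "W = D2 + 2 *\<^sub>R (K1 ** D1 - D1 ** K1) + (K2 ** Z - Z ** K2)
      + (K1 ** K1 ** Z - 2 *\<^sub>R (K1 ** Z ** K1) + Z ** K1 ** K1)"
  shows "jet2 (\<lambda>t. Pi_plus (Z + t *\<^sub>R H + (t\<^sup>2 / 2) *\<^sub>R W)) (Pi_plus Z) (dir1 Pi_plus Z H)
    (pos_proj Z ** D2 ** pos_proj Z + dir1 Pi_plus (R ** D1 ** R) (R ** D2 ** R) + (K2 ** Pi_plus Z - Pi_plus Z ** K2)
      + (2 *\<^sub>R (K1 ** (pos_proj Z ** D1 ** pos_proj Z + Pi_plus (R ** D1 ** R))
              - (pos_proj Z ** D1 ** pos_proj Z + Pi_plus (R ** D1 ** R)) ** K1)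
        + (K1 ** K1 ** Pi_plus Z - 2 *\<^sub>R (K1 ** Pi_plus Z ** K1) + Pi_plus Z ** K1 ** K1)))"
proof -
  have RT: "transpose R = R" by (simp add: R SymD ker_proj_Sym)
  have RD: "R ** D1 ** R \<in> Sym" "R ** D2 ** R \<in> Sym"
    using Sym_congruence[OF D1(1), of R] Sym_congruence[OF D2(1), of R] by (simp_all add: RT)
  have q: "((\<lambda>t. (1 / (t / 2)) *\<^sub>R (Pi_plus (R ** D1 ** R + (t / 2) *\<^sub>R (R ** D2 ** R)) - Pi_plus (R ** D1 ** R)))
      \<longlongrightarrow> dir1 Pi_plus (R ** D1 ** R) (R ** D2 ** R)) (at_right 0)"
    using filterlim_compose[OF tendsto_dir1_Pi_plus[OF RD] filterlim_mult_at_right[of "1/2"]] by simp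
  from jet2_Pi_plus_expansion[OF Z D1 D2 K R q H W refl]
    dir1_eqI[OF tendsto_dir1_Pi_plus_blocks[OF Z D1 K(1) H], folded R]
  show ?thesis by (simp add: ac_simps)
qed

text \<open>The shift by \<open>Upsilon\<close> cancels the curvature term on \<open>ker Z\<close>, so that the kernel block of the
  commuting part of \<open>V\<close> is the direction in which \<open>Pi_plus\<close> is differentiated at the kernel block of \<open>H\<close>.\<close>
lemma Theta_expansion:
  fixes Z H :: "real^'n::finite^'n"
  assumes Z: "Z \<in> Sym" and H: "H \<in> Sym"
  shows "Upsilon Z H \<in> Sym"
    and "V \<in> Sym \<Longrightarrow> jet2 (\<lambda>t. Pi_plus (Z + t *\<^sub>R H + (t\<^sup>2 / 2) *\<^sub>R (V + Upsilon Z H)))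
      (Pi_plus Z) (dir1 Pi_plus Z H) (dir2 Pi_plus Z H (V + Upsilon Z H))"
    and "\<exists>H0\<in>Sym. \<forall>D K. D \<in> Sym \<longrightarrow> D ** Z = Z ** D \<longrightarrow> transpose K = - K \<longrightarrow>
      Theta Z H (D + (K ** Z - Z ** K)) = pos_proj Z ** D ** pos_proj Z
        + dir1 Pi_plus H0 (ker_proj Z ** D ** ker_proj Z) + (K ** Pi_plus Z - Pi_plus Z ** K)"
proof -
  define R where "R = ker_proj Z"
  have R: "transpose R = R" "R ** R = R" "Z ** R = 0" "R ** Z = 0"
    by (simp_all add: R_def SymD ker_proj_Sym ker_proj_idem mult_ker_proj ker_proj_mult Z)
  have ZT: "transpose Z = Z" by (rule SymD[OF Z])
  obtain D1 K where D1: "D1 \<in> Sym" "D1 ** Z = Z ** D1" and K: "transpose K = - K" "H = D1 + (K ** Z - Z ** K)"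
    using commutator_decomposition[OF assms] by metis
  \<comment> \<open>The kernel block of \<open>K\<close> commutes with \<open>Z\<close>, so removing
    it keeps \<open>H\<close> and normalizes \<open>R ** K1 ** R = 0\<close>.\<close>
  define K1 where "K1 = K - R ** K ** R"
  have K1: "transpose K1 = - K1" by (simp add: K1_def transpose_simps K R matrix_distribs matrix_mul_assoc)
  have RZ: "R ** K ** R ** Z = 0" "Z ** (R ** K ** R) = 0"
    by (simp_all add: R flip: matrix_mul_assoc) (simp add: R matrix_mul_assoc)
  have H1: "H = D1 + (K1 ** Z - Z ** K1)" by (simp add: K K1_def matrix_distribs RZ)
  have RK: "R ** K1 ** R = 0"
    by (simp add: K1_def matrix_distribs matrix_mul_assoc R) (simp add: R flip: matrix_mul_assoc)
  have DR: "D1 ** R = R ** D1 ** R" "R ** D1 = R ** D1 ** R"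
    unfolding R_def using commuting_blocks[OF Z D1] by simp_all
  define Y where "Y = Upsilon Z H"
  \<comment> \<open>The normalized rotation is read off from \<open>H\<close>, which expresses
    \<open>Upsilon\<close> through \<open>K1\<close>.\<close>
  have RHp: "R ** H ** pinv Z = R ** K1"
  proof -
    have "R ** H ** pinv Z = (R ** D1) ** pinv Z + R ** K1 ** (Z ** pinv Z) - (R ** Z) ** K1 ** pinv Z"
      by (simp add: H1 matrix_distribs matrix_mul_assoc)
    also have "(R ** D1) ** pinv Z = (R ** D1 ** R) ** pinv Z" by (simp flip: DR(2))
    also have "\<dots> = 0" using pinv_mult(2)[OF Z] by (simp add: R_def flip: matrix_mul_assoc)
    finally show ?thesis using pinv_mult(1)[OF Z] RK by (simp add: R matrix_distribs flip: R_def)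
  qed
  have "R ** K1 ** H ** R = R ** K1 ** (D1 ** R) + R ** K1 ** K1 ** (Z ** R) - R ** K1 ** Z ** K1 ** R"
    by (simp add: H1 matrix_distribs matrix_mul_assoc)
  also have "R ** K1 ** (D1 ** R) = (R ** K1 ** R) ** D1 ** R"
    by (subst DR(1)) (simp add: matrix_mul_assoc)
  finally have "R ** K1 ** H ** R = - (R ** K1 ** Z ** K1 ** R)" by (simp add: R RK)
  then have Y: "Y = - 2 *\<^sub>R (R ** K1 ** Z ** K1 ** R)"
    by (simp add: Y_def Upsilon_def RHp flip: R_def)
  have YS: "Y \<in> Sym" by (simp add: Y Sym_def transpose_simps matrix_distribs matrix_mul_assoc R K1 ZT)
  \<comment> \<open>The second-order term forced by \<open>D1\<close> and \<open>K1\<close>; it is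
    subtracted before the commutator decomposition is applied.\<close>
  define F where "F = 2 *\<^sub>R (K1 ** D1 - D1 ** K1) + (K1 ** K1 ** Z - 2 *\<^sub>R (K1 ** Z ** K1) + Z ** K1 ** K1)"
  have FS: "F \<in> Sym"
    by (simp add: F_def Sym_def transpose_simps matrix_distribs matrix_mul_assoc K1 ZT SymD[OF D1(1)])
  obtain DY KY where DY: "DY \<in> Sym" "DY ** Z = Z ** DY" and KY: "transpose KY = - KY"
    and YF: "Y - F = DY + (KY ** Z - Z ** KY)"
    using commutator_decomposition[OF Z Sym_diff[OF YS FS]] by metis
  \<comment> \<open>The kernel block of \<open>F\<close> is exactly \<open>Y\<close>, so that of
    \<open>Y - F\<close> vanishes; commutators with \<open>Z\<close> contribute nothing to
    it.\<close>
  have RDY: "R ** DY ** R = 0"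
  proof -
    have "R ** F ** R = 2 *\<^sub>R (R ** K1 ** (D1 ** R) - (R ** D1) ** K1 ** R)
        + (R ** K1 ** K1 ** (Z ** R) - 2 *\<^sub>R (R ** K1 ** Z ** K1 ** R) + (R ** Z) ** K1 ** K1 ** R)"
      by (simp add: F_def matrix_distribs matrix_mul_assoc)
    also have "R ** K1 ** (D1 ** R) = (R ** K1 ** R) ** D1 ** R"
      by (subst DR(1)) (simp add: matrix_mul_assoc)
    also have "(R ** D1) ** K1 ** R = R ** D1 ** (R ** K1 ** R)"
      by (subst DR(2)) (simp add: matrix_mul_assoc)
    finally have RFR: "R ** F ** R = - 2 *\<^sub>R (R ** K1 ** Z ** K1 ** R)" by (simp add: R RK)
    have "R ** Y ** R = Y" by (simp add: Y matrix_distribs matrix_mul_assoc R) (simp add: R flip: matrix_mul_assoc)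
    then have "R ** (Y - F) ** R = 0" using RFR Y by (simp add: matrix_distribs)
    moreover have "R ** (Y - F) ** R = R ** DY ** R + R ** KY ** (Z ** R) - (R ** Z) ** KY ** R"
      unfolding YF by (simp add: matrix_distribs matrix_mul_assoc)
    ultimately show ?thesis by (simp add: R)
  qed
  define B where "B = 2 *\<^sub>R (K1 ** (pos_proj Z ** D1 ** pos_proj Z + Pi_plus (R ** D1 ** R))
              - (pos_proj Z ** D1 ** pos_proj Z + Pi_plus (R ** D1 ** R)) ** K1)
        + (K1 ** K1 ** Pi_plus Z - 2 *\<^sub>R (K1 ** Pi_plus Z ** K1) + Pi_plus Z ** K1 ** K1)"
  have jet: "jet2 (\<lambda>t. Pi_plus (Z + t *\<^sub>R H + (t\<^sup>2 / 2) *\<^sub>R (V + Y))) (Pi_plus Z) (dir1 Pi_plus Z H)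
      (pos_proj Z ** (DY + D) ** pos_proj Z + dir1 Pi_plus (R ** D1 ** R) (R ** D ** R)
        + ((KY + L) ** Pi_plus Z - Pi_plus Z ** (KY + L)) + B)"
    if D: "D \<in> Sym" "D ** Z = Z ** D" and L: "transpose L = - L" and V: "V = D + (L ** Z - Z ** L)" for D L V
  proof -
    have DD: "DY + D \<in> Sym" "(DY + D) ** Z = Z ** (DY + D)"
      by (simp_all add: Sym_add DY D matrix_distribs)
    have LL: "transpose (KY + L) = - (KY + L)" by (simp add: transpose_simps KY L)
    have Y': "Y = DY + (KY ** Z - Z ** KY) + F" using YF by (simp add: diff_eq_eq)
    have "V + Y = (DY + D) + 2 *\<^sub>R (K1 ** D1 - D1 ** K1) + ((KY + L) ** Z - Z ** (KY + L))
      + (K1 ** K1 ** Z - 2 *\<^sub>R (K1 ** Z ** K1) + Z ** K1 ** K1)"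
      unfolding V F_def by (subst Y') (simp add: F_def matrix_distribs)
    from jet2_dir2_Pi_plus_blocks[OF Z D1 DD K1 LL R_def H1 this] show ?thesis
      by (simp add: B_def matrix_distribs(1,2) RDY)
  qed
  have dir2: "dir2 Pi_plus Z H (V + Y) = (pos_proj Z ** (DY + D) ** pos_proj Z + dir1 Pi_plus (R ** D1 ** R) (R ** D ** R)
        + ((KY + L) ** Pi_plus Z - Pi_plus Z ** (KY + L)) + B)"
    if D: "D \<in> Sym" "D ** Z = Z ** D" and L: "transpose L = - L" and V: "V = D + (L ** Z - Z ** L)" for D L V
    by (rule dir2_eqI[OF jet[OF that]])
  have dir2Y: "dir2 Pi_plus Z H Y = pos_proj Z ** DY ** pos_proj Z
        + (KY ** Pi_plus Z - Pi_plus Z ** KY) + B"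
    using dir2[of 0 0 0] by (simp add: subspace_0[OF subspace_Sym] transpose_zero dir1_0)
  show "Upsilon Z H \<in> Sym" using YS by (simp add: Y_def)
  show "jet2 (\<lambda>t. Pi_plus (Z + t *\<^sub>R H + (t\<^sup>2 / 2) *\<^sub>R (V + Upsilon Z H)))
    (Pi_plus Z) (dir1 Pi_plus Z H) (dir2 Pi_plus Z H (V + Upsilon Z H))" if V: "V \<in> Sym"
  proof -
    obtain D L where DL: "D \<in> Sym" "D ** Z = Z ** D" "transpose L = - L" "V = D + (L ** Z - Z ** L)"
      using commutator_decomposition[OF Z V] by metis
    show ?thesis using jet[OF DL] unfolding dir2[OF DL, symmetric] Y_def .
  qed
  show "\<exists>H0\<in>Sym. \<forall>D K. D \<in> Sym \<longrightarrow> D ** Z = Z ** D \<longrightarrow> transpose K = - K \<longrightarrow>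
      Theta Z H (D + (K ** Z - Z ** K)) = pos_proj Z ** D ** pos_proj Z
        + dir1 Pi_plus H0 (ker_proj Z ** D ** ker_proj Z) + (K ** Pi_plus Z - Pi_plus Z ** K)"
  proof (intro bexI allI impI)
    show "R ** D1 ** R \<in> Sym" using Sym_congruence[OF D1(1), of R] by (simp add: R)
    fix D L :: "real^'n^'n" assume D: "D \<in> Sym" "D ** Z = Z ** D" and L: "transpose L = - L"
    show "Theta Z H (D + (L ** Z - Z ** L)) = pos_proj Z ** D ** pos_proj Z
        + dir1 Pi_plus (R ** D1 ** R) (ker_proj Z ** D ** ker_proj Z) + (L ** Pi_plus Z - Pi_plus Z ** L)"
      unfolding Theta_def Y_def[symmetric] R_def[symmetric] dir2[OF D L refl] dir2Y
      by (simp add: matrix_distribs)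
  qed
qed

text \<open>The blocks of \<open>V\<close> enter linearly, except for a first derivative at the
  fixed \<open>H0\<close>, which is positively homogeneous.\<close>

lemma Theta_scaleR:
  fixes Z H :: "real^'n::finite^'n"
  assumes Z: "Z \<in> Sym" and H: "H \<in> Sym" and V: "V \<in> Sym" and c: "c \<ge> 0"
  shows "Theta Z H (c *\<^sub>R V) = c *\<^sub>R Theta Z H V"
proof -
  obtain H0 where H0: "H0 \<in> Sym" and Th: "\<And>D K. D \<in> Sym \<Longrightarrow> D ** Z = Z ** D \<Longrightarrow> transpose K = - K \<Longrightarrow>
      Theta Z H (D + (K ** Z - Z ** K)) = pos_proj Z ** D ** pos_proj Z
        + dir1 Pi_plus H0 (ker_proj Z ** D ** ker_proj Z) + (K ** Pi_plus Z - Pi_plus Z ** K)"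
    using Theta_expansion(3)[OF Z H] by blast
  obtain D K where D: "D \<in> Sym" "D ** Z = Z ** D" and K: "transpose K = - K" and VD: "V = D + (K ** Z - Z ** K)"
    using commutator_decomposition[OF Z V] by metis
  have e: "c *\<^sub>R V = c *\<^sub>R D + ((c *\<^sub>R K) ** Z - Z ** (c *\<^sub>R K))"
    by (simp add: VD matrix_distribs scaleR_right_distrib scaleR_right_diff_distrib)
  have RD: "ker_proj Z ** D ** ker_proj Z \<in> Sym"
    using Sym_congruence[OF D(1), of "ker_proj Z"] by (simp add: SymD ker_proj_Sym)
  have "Theta Z H (c *\<^sub>R V) = pos_proj Z ** (c *\<^sub>R D) ** pos_proj Z
        + dir1 Pi_plus H0 (ker_proj Z ** (c *\<^sub>R D) ** ker_proj Z) + ((c *\<^sub>R K) ** Pi_plus Z - Pi_plus Z ** (c *\<^sub>R K))"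
    unfolding e by (rule Th) (simp_all add: Sym_scaleR D matrix_distribs transpose_simps K)
  also have "\<dots> = c *\<^sub>R Theta Z H V"
    unfolding VD Th[OF D K]
    by (simp add: matrix_distribs dir1_Pi_plus_scaleR[OF H0 RD c] scaleR_right_distrib scaleR_right_diff_distrib)
  finally show ?thesis .
qed

section \<open>Second derivatives of both projections and firmness of \<open>Theta\<close>\<close>

lemma jet2_dir2_Pi_plus:
  fixes Z H W :: "real^'n::finite^'n"
  assumes Z: "Z \<in> Sym" and H: "H \<in> Sym" and W: "W \<in> Sym"
  shows "jet2 (\<lambda>t. Pi_plus (Z + t *\<^sub>R H + (t\<^sup>2 / 2) *\<^sub>R W)) (Pi_plus Z) (dir1 Pi_plus Z H) (dir2 Pi_plus Z H W)"
proof -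
  from Theta_expansion(2)[OF Z H Sym_diff[OF W Theta_expansion(1)[OF Z H]]] show ?thesis by simp
qed

lemmas Upsilon_Sym = Theta_expansion(1)

lemma dir1_Pi_plus_Sym:
  assumes "Z \<in> Sym" "H \<in> Sym"
  shows "dir1 Pi_plus Z H \<in> Sym"
  by (rule Lim_in_closed_set[OF closed_Sym _ _ tendsto_dir1_Pi_plus[OF assms]])
    (simp_all add: Sym_scaleR Sym_diff Pi_plus_Sym)

lemma dir2_Pi_plus_Sym:
  assumes "Z \<in> Sym" "H \<in> Sym" "W \<in> Sym"
  shows "dir2 Pi_plus Z H W \<in> Sym"
  by (rule Lim_in_closed_set[OF closed_Sym _ _ jet2_dir2_Pi_plus[OF assms, unfolded jet2_def]])
    (simp_all add: Sym_scaleR Sym_diff Pi_plus_Sym dir1_Pi_plus_Sym assms)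

lemma dir2_Pi_minus:
  fixes Z H W :: "real^'n::finite^'n"
  assumes Z: "Z \<in> Sym" and H: "H \<in> Sym" and W: "W \<in> Sym"
  shows "dir2 Pi_minus Z H W = W - dir2 Pi_plus Z H W"
proof -
  have "((\<lambda>t. H - (1 / t) *\<^sub>R (Pi_plus (Z + t *\<^sub>R H) - Pi_plus Z)) \<longlongrightarrow> H - dir1 Pi_plus Z H) (at_right 0)"
    by (intro tendsto_diff tendsto_const tendsto_dir1_Pi_plus Z H)
  then have "((\<lambda>t. (1 / t) *\<^sub>R (Pi_minus (Z + t *\<^sub>R H) - Pi_minus Z)) \<longlongrightarrow> H - dir1 Pi_plus Z H) (at_right 0)"
  proof (rule Lim_transform_eventually)
    show "eventually (\<lambda>t. H - (1 / t) *\<^sub>R (Pi_plus (Z + t *\<^sub>R H) - Pi_plus Z)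
        = (1 / t) *\<^sub>R (Pi_minus (Z + t *\<^sub>R H) - Pi_minus Z)) (at_right 0)"
      using eventually_pos_at_right
    proof eventually_elim
      case (elim t)
      have "Pi_minus (Z + t *\<^sub>R H) - Pi_minus Z = t *\<^sub>R H - (Pi_plus (Z + t *\<^sub>R H) - Pi_plus Z)"
        by (simp add: Pi_minus_eq Z H Sym_add Sym_scaleR)
      then show ?case using elim by (simp add: scaleR_diff_right)
    qed
  qed
  then have d1: "dir1 Pi_minus Z H = H - dir1 Pi_plus Z H" by (rule dir1_eqI)
  have "jet2 (\<lambda>t. Pi_minus (Z + t *\<^sub>R H + (t\<^sup>2 / 2) *\<^sub>R W)) (Z - Pi_plus Z) (H - dir1 Pi_plus Z H) (W - dir2 Pi_plus Z H W)"
    using jet2_diff[OF jet2_quadratic[of Z H W] jet2_dir2_Pi_plus[OF assms]]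
    by (simp add: Pi_minus_eq Z H W Sym_add Sym_scaleR)
  then show ?thesis by (intro dir2_eqI) (simp add: d1 Pi_minus_eq Z)
qed

lemma Theta_perp_eq:
  assumes "Z \<in> Sym" "H \<in> Sym" "V \<in> Sym"
  shows "Theta_perp Z H V = V - Theta Z H V"
  by (simp add: Theta_perp_def Theta_def dir2_Pi_minus assms Sym_add Upsilon_Sym)

lemma Theta_Sym:
  assumes "Z \<in> Sym" "H \<in> Sym" "V \<in> Sym"
  shows "Theta Z H V \<in> Sym"
  by (simp add: Theta_def dir2_Pi_plus_Sym assms Sym_add Sym_diff Upsilon_Sym)

text \<open>Two expansions with the same \<open>H\<close> agree up to first order, so the difference
  is a limit of rescaled differences of projections, whose arguments differ by exactly
  \<open>V - V'\<close> after rescaling.\<close>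

lemma Theta_firmly_nonexpansive:
  fixes Z H :: "real^'n::finite^'n"
  assumes Z: "Z \<in> Sym" and H: "H \<in> Sym" and V: "V \<in> Sym" "V' \<in> Sym"
  shows "(Theta Z H V - Theta Z H V') \<bullet> (Theta Z H V - Theta Z H V') \<le> (Theta Z H V - Theta Z H V') \<bullet> (V - V')"
proof -
  let ?Y = "Upsilon Z H"
  define y where "y V t = Z + t *\<^sub>R H + (t\<^sup>2 / 2) *\<^sub>R (V + ?Y)" for V t
  define p where "p t = (1 / (t\<^sup>2 / 2)) *\<^sub>R (Pi_plus (y V t) - Pi_plus (y V' t))" for t
  have S: "V + ?Y \<in> Sym" "V' + ?Y \<in> Sym" by (simp_all add: Sym_add V Upsilon_Sym Z H)
  have "jet2 (\<lambda>t. Pi_plus (y V t) - Pi_plus (y V' t)) 0 0 (Theta Z H V - Theta Z H V')"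
    using jet2_diff[OF jet2_dir2_Pi_plus[OF Z H S(1)] jet2_dir2_Pi_plus[OF Z H S(2)]]
    by (simp add: y_def Theta_def)
  then have p: "(p \<longlongrightarrow> Theta Z H V - Theta Z H V') (at_right 0)"
    by (simp add: jet2_def p_def[abs_def])
  have "eventually (\<lambda>t. p t \<bullet> p t \<le> p t \<bullet> (V - V')) (at_right 0)"
    using eventually_pos_at_right
  proof eventually_elim
    case (elim t)
    define s where "s = 1 / (t\<^sup>2 / 2)"
    have pt: "p t = s *\<^sub>R (Pi_plus (y V t) - Pi_plus (y V' t))" by (simp only: p_def s_def)
    have "V - V' = s *\<^sub>R (y V t - y V' t)"
      using elim by (simp add: s_def y_def flip: scaleR_diff_right)
    then have "p t \<bullet> (V - V') - p t \<bullet> p t = (s * s) *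
        ((Pi_plus (y V t) - Pi_plus (y V' t)) \<bullet> (y V t - y V' t)
          - (Pi_plus (y V t) - Pi_plus (y V' t)) \<bullet> (Pi_plus (y V t) - Pi_plus (y V' t)))"
      by (simp add: pt right_diff_distrib mult.assoc)
    also have "\<dots> \<ge> 0"
      using firmly_nonexpansiveD[OF firmly_nonexpansive_Pi_plus] by (intro mult_nonneg_nonneg) (auto simp: s_def)
    finally show ?case by simp
  qed
  then show ?thesis
    by (rule tendsto_le[OF _ tendsto_inner[OF p tendsto_const] tendsto_inner[OF p p], rotated]) simp
qed

section \<open>The iteration\<close>

lemma Aop_nth: "\<forall>i. A i \<in> Sym \<Longrightarrow> Aop A X $ i = A i \<bullet> X"
  by (simp add: Aop_def sinner_eq_inner)

lemma Aadj_inner: "\<forall>i. A i \<in> Sym \<Longrightarrow> Aadj A y \<bullet> X = y \<bullet> Aop A X"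
  by (simp add: Aadj_def inner_sum_left inner_vec_def[of y] Aop_nth)

lemma linear_Aop: "\<forall>i. A i \<in> Sym \<Longrightarrow> linear (Aop A)"
  by (rule linearI) (simp_all add: vec_eq_iff Aop_nth inner_add_right)

lemma linear_Aadj: "linear (Aadj A)"
  by (rule linearI) (simp_all add: Aadj_def scaleR_left_distrib sum.distrib scaleR_sum_right)

lemma AAadj_mult: "\<forall>i. A i \<in> Sym \<Longrightarrow> AAadj A *v y = Aop A (Aadj A y)"
  by (simp add: vec_eq_iff Aop_nth AAadj_def matrix_vector_mult_def sinner_eq_inner Aadj_def inner_sum_right mult.commute)

text \<open>A null vector \<open>y\<close> satisfies \<open>Aadj A y = 0\<close>; pairing this with
  a preimage of \<open>y\<close> under \<open>Aop A\<close> gives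
  \<open>y \<bullet> y = 0\<close>.\<close>

lemma AAadj_invertible:
  assumes A: "\<forall>i. A i \<in> Sym" and surj: "Aop A ` Sym = UNIV"
  shows "invertible (AAadj A)"
proof -
  have "y = 0" if "AAadj A *v y = 0" for y
  proof -
    have "Aadj A y \<bullet> Aadj A y = y \<bullet> (AAadj A *v y)" by (simp add: Aadj_inner A AAadj_mult)
    then have "Aadj A y = 0" using that by simp
    moreover obtain X where "Aop A X = y" using surj by (metis UNIV_I imageE)
    ultimately have "y \<bullet> y = 0" using Aadj_inner[OF A, of y X] by simp
    then show ?thesis by simp
  qed
  then show ?thesis
    by (metis invertible_left_inverse matrix_left_invertible_ker)
qed

lemma linear_Pop:
  assumes "\<forall>i. A i \<in> Sym"
  shows "linear (Pop A)"
proof -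
  have "Pop A = Aadj A \<circ> (*v) (matrix_inv (AAadj A)) \<circ> Aop A" by (auto simp: Pop_def)
  then show ?thesis
    by (simp only:) (intro linear_compose linear_Aop linear_Aadj assms matrix_vector_mul_linear)
qed

lemma Pop_Sym: "\<forall>i. A i \<in> Sym \<Longrightarrow> Pop A X \<in> Sym"
  unfolding Pop_def Aadj_def by (intro subspace_sum[OF subspace_Sym] Sym_scaleR) auto

text \<open>\<open>Pop A X\<close> lies in the range of the adjoint, and \<open>Pperp A Y\<close> in
  the kernel of \<open>Aop A\<close>.\<close>

lemma Pop_Pperp_orthogonal:
  assumes A: "\<forall>i. A i \<in> Sym" and surj: "Aop A ` Sym = UNIV"
  shows "Pop A X \<bullet> Pperp A Y = 0"
proof -
  have inv: "AAadj A ** matrix_inv (AAadj A) = mat 1"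
    using AAadj_invertible[OF A surj] unfolding invertible_def matrix_inv_def by (rule someI2_ex) simp
  have "Aop A (Pop A Y) = (AAadj A ** matrix_inv (AAadj A)) *v Aop A Y"
    by (simp add: Pop_def AAadj_mult[OF A, symmetric] matrix_vector_mul_assoc)
  also have "\<dots> = Aop A Y" by (simp add: inv)
  finally have "Aop A (Pperp A Y) = 0"
    by (simp add: Pperp_def linear_diff[OF linear_Aop[OF A]])
  then show ?thesis unfolding Pop_def Aadj_inner[OF A] by simp
qed

text \<open>Exchanging the \<open>Pperp\<close> components of \<open>\<theta>\<close> and
  \<open>a - \<theta>\<close> turns them into \<open>g\<close> and \<open>a - g\<close>, and by
  orthogonality preserves their inner product.\<close>

lemma Pop_Pperp_mix_firm:
  assumes A: "\<forall>i. A i \<in> Sym" and surj: "Aop A ` Sym = UNIV"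
    and th: "\<theta> \<bullet> \<theta> \<le> \<theta> \<bullet> a" and g: "g = Pop A \<theta> + Pperp A (a - \<theta>)"
  shows "g \<bullet> g \<le> g \<bullet> a"
proof -
  define p p' r r' where "p = Pop A \<theta>" and "p' = Pperp A \<theta>" and "r = Pop A (a - \<theta>)" and "r' = Pperp A (a - \<theta>)"
  have o: "p \<bullet> p' = 0" "p \<bullet> r' = 0" "r \<bullet> p' = 0" "r \<bullet> r' = 0"
    by (simp_all add: p_def p'_def r_def r'_def Pop_Pperp_orthogonal A surj)
  have th_eq: "\<theta> = p + p'" and a_eq: "a = p + p' + (r + r')"
    by (simp_all add: p_def p'_def r_def r'_def Pperp_def)
  have g_eq: "g = p + r'" by (simp add: g p_def r'_def)
  have "\<theta> \<bullet> (a - \<theta>) \<ge> 0" using th by (simp add: inner_diff_right)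
  moreover have "\<theta> \<bullet> (a - \<theta>) = g \<bullet> a - g \<bullet> g"
    unfolding g_eq th_eq using o by (simp add: a_eq inner_add_left inner_add_right inner_commute)
  ultimately show ?thesis by simp
qed

text \<open>The orthogonal projection onto \<open>Sym\<close>. Precomposing with it extends maps
  known only on \<open>Sym\<close> to the whole matrix space, as the results on firmly nonexpansive
  maps require.\<close>

definition sym_part :: "real^'n^'n \<Rightarrow> real^'n^'n" where
  "sym_part X = (1/2) *\<^sub>R (X + transpose X)"

lemma sym_part_Sym: "sym_part X \<in> Sym"
  by (simp add: sym_part_def Sym_def transpose_simps add.commute)

lemma sym_part_id: "X \<in> Sym \<Longrightarrow> sym_part X = X"
  by (simp add: sym_part_def SymD flip: scaleR_2)

lemma sym_part_scaleR: "sym_part (c *\<^sub>R X) = c *\<^sub>R sym_part X"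
  by (simp add: sym_part_def transpose_simps scaleR_right_distrib)

lemma inner_sym_part:
  assumes "S \<in> Sym"
  shows "S \<bullet> sym_part X = S \<bullet> X"
  using inner_transpose[of S X] by (simp add: sym_part_def SymD[OF assms] inner_add_right)

lemma Zstar_Sym:
  assumes "Z \<in> Zstar \<sigma> C A b"
  shows "Z \<in> Sym"
proof -
  obtain X S where "Z = X - \<sigma> *\<^sub>R S" "X \<in> PSD" "S \<in> PSD"
    using assms unfolding Zstar_def Xstar_def Sstar_def KKT_def by blast
  then show ?thesis by (simp add: Sym_diff Sym_scaleR PSD_Sym)
qed

section \<open>Identification of the limit of the increments\<close>

theorem theorem4p8:
  fixes C :: "real^'n::finite^'n" and A :: "'m::finite \<Rightarrow> real^'n^'n" and b :: "real^'m"
    and \<sigma> :: real and Zbar Hbar W0 :: "real^'n^'n" and W :: "nat \<Rightarrow> real^'n^'n"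
  assumes C_sym: "C \<in> Sym" and A_sym: "\<forall>i. A i \<in> Sym"
    and A1: "Aop A ` Sym = UNIV"
    and A2: "\<exists>X y S. KKT C A b X y S \<and> rank X + rank S = CARD('n)"
    and sigma: "\<sigma> > 0"
    and Zbar: "Zbar \<in> Zstar \<sigma> C A b"
    and Hbar: "Hbar \<in> critical_cone A Zbar"
    and W0: "W0 \<in> Sym"
    and W_0: "W 0 = W0"
    and W_Suc: "\<forall>k. W (Suc k) = Pperp A (Theta Zbar Hbar (W k)) + Pop A (Theta_perp Zbar Hbar (W k))
                               + Psi A Zbar Hbar"
  shows "((\<lambda>k. W (Suc k) - W k) \<longlongrightarrow> Psi A Zbar Hbar - closest_point (Kcone A Zbar Hbar) (Psi A Zbar Hbar)) sequentially
       \<and> Psi A Zbar Hbar - closest_point (Kcone A Zbar Hbar) (Psi A Zbar Hbar)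
           = closest_point (Kpolar A Zbar Hbar) (Psi A Zbar Hbar)
       \<and> closed (Kcone A Zbar Hbar) \<and> convex (Kcone A Zbar Hbar) \<and> cone (Kcone A Zbar Hbar)
       \<and> closed (Kpolar A Zbar Hbar) \<and> convex (Kpolar A Zbar Hbar) \<and> cone (Kpolar A Zbar Hbar)"
proof -
  have Z: "Zbar \<in> Sym" by (rule Zstar_Sym[OF Zbar])
  have H: "Hbar \<in> Sym" using Hbar by (simp add: critical_cone_def)
  define T where "T = Theta Zbar Hbar"
  define \<Psi> where "\<Psi> = Psi A Zbar Hbar"
  have TS: "T V \<in> Sym" if "V \<in> Sym" for V unfolding T_def by (rule Theta_Sym[OF Z H that])
  have Tp: "Theta_perp Zbar Hbar V = V - T V" if "V \<in> Sym" for V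
    unfolding T_def by (rule Theta_perp_eq[OF Z H that])
  note linP = linear_Pop[OF A_sym]
  have PS: "Pop A X \<in> Sym" for X by (rule Pop_Sym[OF A_sym])
  have PpS: "Pperp A X \<in> Sym" if "X \<in> Sym" for X unfolding Pperp_def by (rule Sym_diff[OF that PS])
  have \<Psi>S: "\<Psi> \<in> Sym"
    unfolding \<Psi>_def Psi_def delta2_def dir2_Pi_minus[OF Z H Upsilon_Sym[OF Z H]]
    by (intro Sym_diff Sym_uminus PS PpS dir2_Pi_plus_Sym Upsilon_Sym Z H)

  define G where "G X = Pop A (T (sym_part X)) + Pperp A (Theta_perp Zbar Hbar (sym_part X))" for X :: "real^'n^'n"
  have G: "G X = Pop A (T (sym_part X)) + Pperp A (sym_part X - T (sym_part X))" for X
    by (simp add: G_def Tp sym_part_Sym)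
  have GS: "G X \<in> Sym" for X unfolding G by (intro Sym_add Sym_diff PS PpS TS sym_part_Sym)
  have firm: "firmly_nonexpansive G"
    unfolding firmly_nonexpansive_def
  proof (intro allI)
    fix X Y :: "real^'n^'n"
    define a where "a = sym_part X - sym_part Y"
    define \<theta> where "\<theta> = T (sym_part X) - T (sym_part Y)"
    have g: "G X - G Y = Pop A \<theta> + Pperp A (a - \<theta>)"
      by (simp add: G a_def \<theta>_def Pperp_def linear_diff[OF linP])
    have th: "\<theta> \<bullet> \<theta> \<le> \<theta> \<bullet> a"
      unfolding \<theta>_def a_def T_def by (intro Theta_firmly_nonexpansive Z H sym_part_Sym)
    have "(G X - G Y) \<bullet> (G X - G Y) \<le> (G X - G Y) \<bullet> a"
      by (rule Pop_Pperp_mix_firm[OF A_sym A1 th g])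
    \<comment> \<open>Values of \<open>G\<close> are symmetric, so the skew part of
      \<open>X - Y\<close> is invisible to them.\<close>
    also have "\<dots> = (G X - G Y) \<bullet> (X - Y)"
      using Sym_diff[OF GS GS, of X Y] by (simp add: a_def inner_diff_right inner_sym_part)
    finally show "(G X - G Y) \<bullet> (G X - G Y) \<le> (G X - G Y) \<bullet> (X - Y)" .
  qed
  have hom: "G (c *\<^sub>R X) = c *\<^sub>R G X" if "c \<ge> 0" for c X
    unfolding G sym_part_scaleR T_def Theta_scaleR[OF Z H sym_part_Sym that]
    by (simp add: linear_cmul[OF linP] Pperp_def linear_diff[OF linP] scaleR_right_distrib scaleR_right_diff_distrib)
  have range_G: "range G = {Pop A (T V) + Pperp A (Theta_perp Zbar Hbar V) | V. V \<in> Sym}"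
  proof (intro set_eqI iffI)
    fix X assume "X \<in> range G"
    then show "X \<in> {Pop A (T V) + Pperp A (Theta_perp Zbar Hbar V) | V. V \<in> Sym}"
      using sym_part_Sym by (auto simp: G_def)
  next
    fix X assume "X \<in> {Pop A (T V) + Pperp A (Theta_perp Zbar Hbar V) | V. V \<in> Sym}"
    then obtain V where "V \<in> Sym" "X = Pop A (T V) + Pperp A (Theta_perp Zbar Hbar V)" by blast
    then have "X = G V" by (simp add: G_def sym_part_id)
    then show "X \<in> range G" by simp
  qed
  have K: "Kcone A Zbar Hbar = closure (range G)"
    by (simp add: Kcone_def range_G T_def)
  have Kp: "Kpolar A Zbar Hbar = {Y \<in> Sym. \<forall>X\<in>range G. X \<bullet> Y \<le> 0}"
  proof -
    have "sinner (Pop A (T V) + Pperp A (Theta_perp Zbar Hbar V)) Y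
        = (Pop A (T V) + Pperp A (Theta_perp Zbar Hbar V)) \<bullet> Y" if "V \<in> Sym" for V Y
      by (rule sinner_eq_inner) (use GS[of V] that in \<open>simp add: G_def sym_part_id\<close>)
    then show ?thesis unfolding Kpolar_def range_G T_def[symmetric] by auto
  qed
  have KS: "closure (range G) \<subseteq> Sym" using GS by (intro closure_minimal closed_Sym) auto

  \<comment> \<open>This one decomposition provides both projections and the limit of the
    increments.\<close>
  obtain k y where ky: "\<Psi> = k + y" "k \<in> closure (range G)" "\<And>X. G X \<bullet> y \<le> 0" "k \<bullet> y = 0"
    using moreau_decomposition_range[OF firm hom, of \<Psi>] by metis
  have yS: "y \<in> Sym" using Sym_diff[of \<Psi> k] \<Psi>S KS ky(1,2) by auto

  have cK: "convex (Kcone A Zbar Hbar)" "cone (Kcone A Zbar Hbar)" "closed (Kcone A Zbar Hbar)"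
    unfolding K by (simp_all add: convex_cone_closure_range[OF firm hom])
  have cKp: "convex (Kpolar A Zbar Hbar)" "cone (Kpolar A Zbar Hbar)" "closed (Kpolar A Zbar Hbar)"
  proof -
    show "convex (Kpolar A Zbar Hbar)"
      unfolding convex_def Kp
      by (auto simp: inner_add_right intro!: Sym_add Sym_scaleR add_nonpos_nonpos mult_nonneg_nonpos)
    show "cone (Kpolar A Zbar Hbar)"
      unfolding cone_def Kp by (auto intro!: Sym_scaleR mult_nonneg_nonpos)
    have "Kpolar A Zbar Hbar = Sym \<inter> (\<Inter>X\<in>range G. {Y. X \<bullet> Y \<le> 0})" unfolding Kp by blast
    then show "closed (Kpolar A Zbar Hbar)"
      by (simp only:) (intro closed_Int closed_INT closed_Sym ballI closed_halfspace_le)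
  qed
  have pK: "closest_point (Kcone A Zbar Hbar) \<Psi> = k"
  proof (rule closest_point_eqI[OF cK(1,3)])
    show "k \<in> Kcone A Zbar Hbar" by (simp add: K ky)
    fix z assume "z \<in> Kcone A Zbar Hbar"
    then have "z \<bullet> y \<le> 0" unfolding K by (rule inner_closure_le_0[rotated]) (use ky(3) in auto)
    then show "(\<Psi> - k) \<bullet> (z - k) \<le> 0" using ky(4) by (simp add: ky(1) inner_diff_right inner_commute)
  qed
  have pKp: "closest_point (Kpolar A Zbar Hbar) \<Psi> = y"
  proof (rule closest_point_eqI[OF cKp(1,3)])
    show "y \<in> Kpolar A Zbar Hbar" using yS ky(3) by (auto simp: Kp)
    fix z assume "z \<in> Kpolar A Zbar Hbar"
    then have "k \<bullet> z \<le> 0" unfolding Kp by (intro inner_closure_le_0[OF _ ky(2)]) auto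
    then show "(\<Psi> - y) \<bullet> (z - y) \<le> 0" using ky(4) by (simp add: ky(1) inner_diff_right)
  qed

  have step: "W (Suc n) = Pperp A (T (W n)) + Pop A (Theta_perp Zbar Hbar (W n)) + \<Psi>" for n
    using W_Suc by (simp add: T_def \<Psi>_def)
  have WS: "W n \<in> Sym" for n
  proof (induction n)
    case 0
    then show ?case by (simp add: W_0 W0)
  next
    case (Suc n)
    then show ?case unfolding step by (intro Sym_add PS PpS TS \<Psi>S)
  qed
  \<comment> \<open>As \<open>Theta\<close> and \<open>Theta_perp\<close> sum to the identity on
    \<open>Sym\<close>, the mixture in the recursion is the complement of \<open>G\<close>.\<close>
  have WG: "W (Suc n) = W n - G (W n) + \<Psi>" for n
    unfolding step G sym_part_id[OF WS] Tp[OF WS] by (simp add: Pperp_def)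
  have "(\<lambda>n. W (Suc n) - W n) \<longlonglongrightarrow> y"
    by (rule firmly_nonexpansive_increments[where w = W, OF firm ky WG])
  then show ?thesis
    unfolding \<Psi>_def[symmetric] using cK cKp by (simp add: pK pKp) (simp add: ky(1))
qed

end
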